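(* Let $G$ be a finite group and let $E$ be a normal subgroup of $G$ such that $G/E$ is nilpotent. Suppose that every minimal subgroup of $E$ is contained in $Z_\infty(G)$, and every cyclic subgroup of $E$ of order $4$ is an $\mathscr{H}C$-subgroup of $G$. Then $G$ is nilpotent.
   Context: All groups are finite. A subgroup $H$ of a group $G$ is an $\mathscr{H}C$-subgroup of $G$ if there exists a normal subgroup $T$ of $G$ such that $G=HT$ and $H^g\cap N_T(H)\leq H$ for all $g\in G$, where $N_T(H)=T\cap N_G(H)$ and $H^g=g^{-1}Hg$. A minimal subgroup is a subgroup of prime order. $Z_\infty(G)$ denotes the hypercenter of $G$, i.e. the final term of the upper central series of $G$. *)

theory Defs
  imports
    "HOL-Algebra.Group_Action"
    "HOL-Algebra.Elementary_Groups"
    "HOL-Computational_Algebra.Primes"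
begin

definition group_center :: "('a, 'b) monoid_scheme \<Rightarrow> 'a set"
  where "group_center G =
    {z \<in> carrier G. \<forall>g \<in> carrier G. z \<otimes>\<^bsub>G\<^esub> g = g \<otimes>\<^bsub>G\<^esub> z}"

text \<open>The term \<open>Z\<^sub>i\<^sub>+\<^sub>1\<close> is the preimage of the center of \<open>G / Z\<^sub>i\<close>
  under the projection \<open>x \<mapsto> Z\<^sub>i x\<close>.\<close>

primrec upper_central :: "('a, 'b) monoid_scheme \<Rightarrow> nat \<Rightarrow> 'a set"
  where
    "upper_central G 0 = {\<one>\<^bsub>G\<^esub>}"
  | "upper_central G (Suc i) =
      {x \<in> carrier G. upper_central G i #>\<^bsub>G\<^esub> x \<in> group_center (G Mod upper_central G i)}"

text \<open>The series is ascending, so in a finite group its union is its final term;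
  see \<open>hypercenter_eq_upper_central\<close> below.\<close>

definition hypercenter :: "('a, 'b) monoid_scheme \<Rightarrow> 'a set"
  where "hypercenter G = (\<Union>i. upper_central G i)"

definition nilpotent_group :: "('a, 'b) monoid_scheme \<Rightarrow> bool"
  where "nilpotent_group G \<longleftrightarrow> (\<exists>n. upper_central G n = carrier G)"

definition minimal_subgroup :: "'a set \<Rightarrow> ('a, 'b) monoid_scheme \<Rightarrow> bool"
  where "minimal_subgroup H G \<longleftrightarrow> subgroup H G \<and> prime (card H)"

definition cyclic_subgroup :: "'a set \<Rightarrow> ('a, 'b) monoid_scheme \<Rightarrow> bool"
  where "cyclic_subgroup H G \<longleftrightarrow> subgroup H G \<and> cyclic_group (G\<lparr>carrier := H\<rparr>)"

definition HC_subgroup :: "'a set \<Rightarrow> ('a, 'b) monoid_scheme \<Rightarrow> bool"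
  where "HC_subgroup H G \<longleftrightarrow> subgroup H G \<and>
    (\<exists>T. T \<lhd> G \<and> carrier G = H <#>\<^bsub>G\<^esub> T \<and>
      (\<forall>g \<in> carrier G.
        (inv\<^bsub>G\<^esub> g <#\<^bsub>G\<^esub> H #>\<^bsub>G\<^esub> g) \<inter> (T \<inter> normalizer G H) \<subseteq> H))"

lemma (in group) group_center_normal: "group_center G \<lhd> G"
proof (rule normal_invI)
  have carr: "a \<in> carrier G" if "a \<in> group_center G" for a
    using that unfolding group_center_def by blast
  have comm: "a \<otimes> g = g \<otimes> a" if "a \<in> group_center G" "g \<in> carrier G" for a g
    using that unfolding group_center_def by blast
  have centerI: "a \<in> group_center G"
    if "a \<in> carrier G" "\<And>g. g \<in> carrier G \<Longrightarrow> a \<otimes> g = g \<otimes> a" for a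
    using that unfolding group_center_def by blast
  show "subgroup (group_center G) G"
  proof (rule subgroupI)
    show "group_center G \<subseteq> carrier G" using carr by blast
    have "\<one> \<in> group_center G" by (rule centerI) simp_all
    then show "group_center G \<noteq> {}" by blast
  next
    fix a assume a: "a \<in> group_center G"
    show "inv a \<in> group_center G"
    proof (rule centerI)
      fix g assume g: "g \<in> carrier G"
      have "inv (inv g \<otimes> a) = inv (a \<otimes> inv g)"
        using comm[OF a, of "inv g"] g by simp
      then show "inv a \<otimes> g = g \<otimes> inv a"
        using carr[OF a] g by (simp add: inv_mult_group)
    qed (simp add: carr[OF a])
  next
    fix a b assume a: "a \<in> group_center G" and b: "b \<in> group_center G"
    show "a \<otimes> b \<in> group_center G"
    proof (rule centerI)
      fix g assume g: "g \<in> carrier G"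
      have "a \<otimes> b \<otimes> g = a \<otimes> (g \<otimes> b)"
        using carr[OF a] carr[OF b] g comm[OF b g] by (simp only: m_assoc)
      also have "\<dots> = a \<otimes> g \<otimes> b"
        using carr[OF a] carr[OF b] g by (simp only: m_assoc)
      also have "\<dots> = g \<otimes> (a \<otimes> b)"
        unfolding comm[OF a g] using carr[OF a] carr[OF b] g by (simp only: m_assoc)
      finally show "a \<otimes> b \<otimes> g = g \<otimes> (a \<otimes> b)" .
    qed (simp add: carr[OF a] carr[OF b])
  qed
  fix x h assume x: "x \<in> carrier G" and h: "h \<in> group_center G"
  have "x \<otimes> h \<otimes> inv x = h \<otimes> (x \<otimes> inv x)"
    unfolding comm[OF h x, symmetric] using x carr[OF h] by (simp only: m_assoc inv_closed)
  then show "x \<otimes> h \<otimes> inv x \<in> group_center G"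
    using x h carr[OF h] by simp
qed

lemma (in group) upper_central_normal: "upper_central G i \<lhd> G"
proof (induction i)
  case 0
  then show ?case by (simp add: one_is_normal)
next
  case (Suc i)
  let ?N = "upper_central G i" and ?Q = "G Mod upper_central G i"
  interpret N: normal ?N G by (fact Suc)
  interpret Q: group ?Q by (fact N.factorgroup_is_group)
  interpret C: normal "group_center ?Q" ?Q by (fact Q.group_center_normal)
  interpret h: group_hom G ?Q "\<lambda>x. ?N #> x"
    by unfold_locales (fact N.r_coset_hom_Mod)
  show ?case
  proof (rule normal_invI)
    show "subgroup (upper_central G (Suc i)) G"
    proof (rule subgroupI)
      show "upper_central G (Suc i) \<subseteq> carrier G" by auto
      have "\<one> \<in> upper_central G (Suc i)"
        using C.one_closed h.hom_one by simp
      then show "upper_central G (Suc i) \<noteq> {}" by blast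
    next
      fix a assume "a \<in> upper_central G (Suc i)"
      then show "inv a \<in> upper_central G (Suc i)"
        by simp
    next
      fix a b assume "a \<in> upper_central G (Suc i)" "b \<in> upper_central G (Suc i)"
      then show "a \<otimes> b \<in> upper_central G (Suc i)"
        using C.m_closed[of "?N #> a" "?N #> b"] h.hom_mult[of a b] by (simp del: h.hom_mult)
    qed
  next
    fix x h assume x: "x \<in> carrier G" and h: "h \<in> upper_central G (Suc i)"
    have "?N #> (x \<otimes> h \<otimes> inv x) =
        (?N #> x) \<otimes>\<^bsub>?Q\<^esub> (?N #> h) \<otimes>\<^bsub>?Q\<^esub> inv\<^bsub>?Q\<^esub> (?N #> x)"
      using x h by (simp del: mult_FactGroup)
    moreover have "\<dots> \<in> group_center ?Q"
      using x h C.inv_op_closed2[OF h.hom_closed[OF x], of "?N #> h"]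
      by (simp del: mult_FactGroup)
    ultimately show "x \<otimes> h \<otimes> inv x \<in> upper_central G (Suc i)"
      using x h by (simp del: h.hom_mult mult_FactGroup)
  qed
qed

lemma (in group) upper_central_mono: "upper_central G i \<subseteq> upper_central G (Suc i)"
proof
  interpret N: normal "upper_central G i" G by (fact upper_central_normal)
  interpret Q: group "G Mod upper_central G i" by (fact N.factorgroup_is_group)
  interpret C: normal "group_center (G Mod upper_central G i)" "G Mod upper_central G i"
    by (fact Q.group_center_normal)
  fix x assume x: "x \<in> upper_central G i"
  then have "upper_central G i #> x = \<one>\<^bsub>G Mod upper_central G i\<^esub>"
    by (simp add: N.rcos_const one_FactGroup)
  then show "x \<in> upper_central G (Suc i)"
    using x N.subset C.one_closed by auto
qed

lemma (in group) hypercenter_eq_upper_central: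
  assumes "finite (carrier G)"
  shows "\<exists>n. hypercenter G = upper_central G n \<and> (\<forall>m \<ge> n. upper_central G m = upper_central G n)"
proof -
  have mono: "upper_central G i \<subseteq> upper_central G j" if "i \<le> j" for i j
    using lift_Suc_mono_le[of "upper_central G", OF upper_central_mono that] .
  have "range (upper_central G) \<subseteq> Pow (carrier G)"
    using normal_imp_subgroup[OF upper_central_normal] subgroup.subset by blast
  then have "finite (range (upper_central G))"
    using assms by (simp add: finite_subset)
  from finite_has_maximal[OF this] obtain n
    where max: "\<And>m. upper_central G n \<subseteq> upper_central G m \<Longrightarrow> upper_central G n = upper_central G m"
    by auto
  have stab: "upper_central G m = upper_central G n" if "m \<ge> n" for m
    using max[OF mono[OF that]] by (rule sym)
  moreover have "upper_central G m \<subseteq> upper_central G n" for m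
    using mono[of m n] stab[of m] by (cases "m \<le> n") auto
  ultimately show ?thesis
    unfolding hypercenter_def by blast
qed

end

theory Submission
  imports Defs "HOL-Algebra.Sylow" "HOL-Algebra.Multiplicative_Group"
begin

text \<open>
  Nilpotency of a finite group is tested on elements: the group is nilpotent if and only if a
  \<open>p\<close>-element and a \<open>q\<close>-element commute whenever \<open>p\<close> and \<open>q\<close> are different primes
  (\<open>nilpotent_imp_primary_commuting\<close> and \<open>primary_commuting_imp_nilpotent\<close>). This
  property, \<open>primary_commuting\<close>, visibly passes to subgroups. The hypotheses of the theorem
  have consequences for elements that pass to subgroups as well (\<open>nilpotency_conditions\<close>):
  elements of prime order \<open>p\<close> in \<open>E\<close> commute with all \<open>q\<close>-elements because they lie in
  the hypercenter, commutators of a \<open>p\<close>-element and a \<open>q\<close>-element lie in \<open>E\<close> because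
  \<open>G / E\<close> is nilpotent, and an element of order 4 in \<open>E\<close> has tightly controlled conjugates.
  So it suffices to refute a group \<open>G\<close> that satisfies these conditions and is minimal
  non-nilpotent: all its proper subgroups are nilpotent, \<open>G\<close> is not.

  Such a group has the shape found by Schmidt. The first step is a proper normal subgroup with
  abelian quotient. Take a maximal proper normal subgroup \<open>N\<close>; if the quotient were not
  abelian, its center would be trivial, any two different maximal subgroups would intersect exactly in
  \<open>N\<close>, each would be its own normalizer, and two conjugacy classes of maximal subgroups would
  already contain more elements than \<open>G\<close> has (\<open>centerless_quotient_absurd\<close>). From the
  abelian quotient one gets a normal \<open>p\<close>-subgroup \<open>P\<close> and a \<open>q\<close>-element \<open>v\<close> that does
  not centralize \<open>P\<close> (\<open>schmidt_structure\<close>).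

  Minimality says that \<open>v\<close> centralizes every proper \<open>v\<close>-invariant subgroup of \<open>P\<close>
  (\<open>invariant_subgroup_fixed\<close>). Hence a \<open>v\<close>-invariant subgroup of \<open>P\<close> that is not contained
  in the centralizer \<open>C\<close> of \<open>v\<close> in \<open>P\<close> is all of \<open>P\<close>. This principle successively shows
  that \<open>C\<close> is normal and central in \<open>P\<close>, that \<open>P / C\<close> is abelian, and that
  \<open>P / C\<close> has exponent \<open>p\<close>. Class two arithmetic then bounds the order of a commutator
  \<open>y = [v, a]\<close> with \<open>a \<in> P\<close>: it divides \<open>p\<close> for odd \<open>p\<close>, and 4 for \<open>p = 2\<close>.
  Choose \<open>a\<close> such that \<open>y\<close> is not in \<open>C\<close>. As \<open>y \<in> E\<close>, its order is not \<open>p\<close>, which leaves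
  \<open>p = 2\<close> and \<open>y\<close> of order 4. The condition on cyclic subgroups of order 4 forces
  \<open>v\<close> to map \<open>y\<close> into \<open>\<langle>y\<rangle> C\<close> (\<open>not_HC_element\<close>). As \<open>\<langle>y\<rangle> C / C\<close> has order 2,
  \<open>v\<close> fixes \<open>y\<close> modulo \<open>C\<close>, and since its order is coprime to \<open>p\<close> it fixes \<open>y\<close>, a
  contradiction.
\<close>

section \<open>Commutators and coprime orders\<close>

definition (in group) commutator :: "'a \<Rightarrow> 'a \<Rightarrow> 'a"
  where "commutator x y = x \<otimes> y \<otimes> inv x \<otimes> inv y"

lemma (in group) inv_mult_cancel [simp]:
  assumes "x \<in> carrier G" "y \<in> carrier G"
  shows "inv x \<otimes> (x \<otimes> y) = y" "x \<otimes> (inv x \<otimes> y) = y"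
  using assms by (simp_all add: m_assoc [symmetric])

text \<open>Together with \<open>inv_mult_cancel\<close> these rules bring a product of elements and inverses
  into reduced form, which decides identities that hold in all groups.\<close>

lemmas (in group) word_simps = m_assoc inv_mult_group

lemma (in group) commutator_closed [simp]:
  "\<lbrakk>x \<in> carrier G; y \<in> carrier G\<rbrakk> \<Longrightarrow> commutator x y \<in> carrier G"
  by (simp add: commutator_def)

lemma (in group) commutator_eq_one_iff:
  assumes "x \<in> carrier G" "y \<in> carrier G"
  shows "commutator x y = \<one> \<longleftrightarrow> x \<otimes> y = y \<otimes> x"
proof -
  have "commutator x y = (x \<otimes> y) \<otimes> inv (y \<otimes> x)"
    using assms by (simp add: commutator_def word_simps)
  then show ?thesis
    using assms by (metis inv_solve_right' l_one m_closed one_closed)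
qed

lemma (in group) commute_pow:
  assumes "x \<in> carrier G" "y \<in> carrier G" "x \<otimes> y = y \<otimes> x"
  shows "x [^] (n::nat) \<otimes> y = y \<otimes> x [^] n"
proof (induction n)
  case (Suc n)
  have "x [^] Suc n \<otimes> y = x [^] n \<otimes> (y \<otimes> x)"
    using assms by (simp add: m_assoc)
  also have "\<dots> = y \<otimes> x [^] Suc n"
    using assms Suc by (simp add: m_assoc [symmetric])
  finally show ?case .
qed (use assms in simp)

lemma (in group) conj_pow:
  assumes "g \<in> carrier G" "x \<in> carrier G"
  shows "(g \<otimes> x \<otimes> inv g) [^] (n::nat) = g \<otimes> x [^] n \<otimes> inv g"
  using assms by (induction n) (simp_all add: word_simps)

text \<open>Conjugation by \<open>v\<close> multiplies \<open>a\<close> by an element that \<open>v\<close> fixes, so that iterating it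
  multiplies by the same element each time. When \<open>v\<close> has finite order prime to that of \<open>c\<close>, this
  makes \<open>c\<close> trivial; all uses of coprime action below are of this kind.\<close>

lemma (in group) conj_pow_shift:
  assumes "v \<in> carrier G" "a \<in> carrier G" "c \<in> carrier G"
    and "v \<otimes> a \<otimes> inv v = c \<otimes> a" and "v \<otimes> c = c \<otimes> v"
  shows "v [^] (n::nat) \<otimes> a \<otimes> inv (v [^] n) = c [^] n \<otimes> a"
proof (induction n)
  case (Suc n)
  have "v [^] Suc n \<otimes> a \<otimes> inv (v [^] Suc n) = v [^] n \<otimes> (v \<otimes> a \<otimes> inv v) \<otimes> inv (v [^] n)"
    using assms(1-3) by (simp add: word_simps)
  also have "\<dots> = (v [^] n \<otimes> c) \<otimes> a \<otimes> inv (v [^] n)"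
    using assms(1-4) by (simp add: word_simps)
  also have "\<dots> = c \<otimes> (v [^] n \<otimes> a \<otimes> inv (v [^] n))"
    using assms(1-3) commute_pow[OF assms(1,3,5), of n] by (simp add: word_simps)
  also have "\<dots> = c [^] Suc n \<otimes> a"
    using assms(1-3) Suc commute_pow[of c c n] by (simp add: word_simps)
  finally show ?case .
qed (use assms in simp)

lemma (in group) coprime_pow_eq_one:
  assumes "x \<in> carrier G" "x [^] (m::nat) = \<one>" "x [^] (n::nat) = \<one>" "coprime m n"
  shows "x = \<one>"
proof -
  have "ord x dvd m" "ord x dvd n"
    using assms by (simp_all add: pow_eq_id)
  with assms(4) have "ord x = 1"
    using coprime_common_divisor_nat by blast
  then show ?thesis using pow_ord_eq_1[OF assms(1)] assms(1) by simp
qed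

text \<open>Conjugating \<open>y\<close> by the powers of \<open>x\<close> shows that the order of the commutator divides
  \<open>m\<close>, and exchanging the roles of \<open>x\<close> and \<open>y\<close> that it divides \<open>n\<close>.\<close>

lemma (in group) central_commutator_trivial:
  assumes x: "x \<in> carrier G" "x [^] (m::nat) = \<one>" and y: "y \<in> carrier G" "y [^] (n::nat) = \<one>"
    and "coprime m n"
    and "commutator x y \<otimes> x = x \<otimes> commutator x y" "commutator x y \<otimes> y = y \<otimes> commutator x y"
  shows "x \<otimes> y = y \<otimes> x"
proof -
  let ?w = "commutator x y"
  have w: "?w \<in> carrier G" using x y by simp
  have "x \<otimes> y \<otimes> inv x = ?w \<otimes> y"
    using x y by (simp add: commutator_def word_simps)
  from conj_pow_shift[OF x(1) y(1) w this assms(6)[symmetric], of m]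
  have "?w [^] m = \<one>"
    using x y w by simp
  have "y \<otimes> inv x \<otimes> inv y = inv x \<otimes> ?w"
    using x y by (simp add: commutator_def word_simps)
  also have "\<dots> = ?w \<otimes> inv x"
    using x w assms(6) by (metis inv_closed inv_solve_left inv_solve_right m_assoc m_closed)
  finally have "y \<otimes> inv x \<otimes> inv y = ?w \<otimes> inv x" .
  from conj_pow_shift[OF y(1) _ w this assms(7)[symmetric], of n]
  have "?w [^] n = \<one>"
    using x y w by simp
  with \<open>?w [^] m = \<one>\<close> have "?w = \<one>"
    using coprime_pow_eq_one[OF w] \<open>coprime m n\<close> by blast
  then show ?thesis using commutator_eq_one_iff x y by blast
qed

section \<open>Elements of prime power order\<close>

definition p_elements :: "nat \<Rightarrow> ('a, 'b) monoid_scheme \<Rightarrow> 'a set"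
  where "p_elements p G = {x \<in> carrier G. \<exists>k. x [^]\<^bsub>G\<^esub> (p ^ k) = \<one>\<^bsub>G\<^esub>}"

text \<open>For finite groups this is equivalent to nilpotency, but it is a statement about pairs of
  elements and is inherited by subgroups without any argument.\<close>

definition primary_commuting :: "('a, 'b) monoid_scheme \<Rightarrow> bool"
  where "primary_commuting G \<longleftrightarrow> (\<forall>p q. \<forall>x \<in> p_elements p G. \<forall>y \<in> p_elements q G.
    prime p \<longrightarrow> prime q \<longrightarrow> p \<noteq> q \<longrightarrow> x \<otimes>\<^bsub>G\<^esub> y = y \<otimes>\<^bsub>G\<^esub> x)"

lemma coprime_prime_powers:
  assumes "prime (p::nat)" "prime q" "p \<noteq> q"
  shows "coprime (p ^ k) (q ^ l)"
  using assms by (simp add: primes_coprime)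

lemma (in group) p_elements_closed: "x \<in> p_elements p G \<Longrightarrow> x \<in> carrier G"
  by (simp add: p_elements_def)

lemma (in group) p_elements_disjoint:
  assumes "prime p" "prime q" "p \<noteq> q" "x \<in> p_elements p G" "x \<in> p_elements q G"
  shows "x = \<one>"
  using assms coprime_pow_eq_one coprime_prime_powers unfolding p_elements_def by blast

lemma (in group) p_elements_pow:
  assumes "x \<in> p_elements p G"
  shows "x [^] (n::nat) \<in> p_elements p G"
proof -
  obtain k where k: "x \<in> carrier G" "x [^] (p ^ k) = \<one>"
    using assms unfolding p_elements_def by blast
  then have "(x [^] n) [^] (p ^ k) = \<one>"
    by (metis mult.commute nat_pow_one nat_pow_pow)
  then show ?thesis using k unfolding p_elements_def by blast
qed

lemma (in group) p_elements_conj: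
  assumes "x \<in> p_elements p G" "g \<in> carrier G"
  shows "g \<otimes> x \<otimes> inv g \<in> p_elements p G"
proof -
  obtain k where "x \<in> carrier G" "x [^] (p ^ k) = \<one>"
    using assms unfolding p_elements_def by blast
  then have "(g \<otimes> x \<otimes> inv g) [^] (p ^ k) = \<one>"
    using assms(2) by (simp add: conj_pow)
  then show ?thesis
    using assms p_elements_closed unfolding p_elements_def by blast
qed

lemma p_elements_subgroup:
  assumes "H \<subseteq> carrier G"
  shows "p_elements p (G\<lparr>carrier := H\<rparr>) = p_elements p G \<inter> H"
  using assms unfolding p_elements_def by (auto simp: nat_pow_def)

lemma (in group) primary_commuting_subgroup:
  assumes "subgroup H G"
  shows "primary_commuting (G\<lparr>carrier := H\<rparr>) \<longleftrightarrow>
    (\<forall>p q. \<forall>x \<in> p_elements p G \<inter> H. \<forall>y \<in> p_elements q G \<inter> H.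
      prime p \<longrightarrow> prime q \<longrightarrow> p \<noteq> q \<longrightarrow> x \<otimes> y = y \<otimes> x)"
  by (simp add: primary_commuting_def p_elements_subgroup subgroup.subset[OF assms])

lemma (in group) commutator_subgroup:
  assumes "subgroup H G" "x \<in> H" "y \<in> H"
  shows "group.commutator (G\<lparr>carrier := H\<rparr>) x y = commutator x y"
  using assms by (simp add: commutator_def group.commutator_def[OF subgroup_imp_group[OF assms(1)]])

section \<open>The upper central series in terms of commutators\<close>

lemma (in normal) rcos_eq_iff:
  assumes "a \<in> carrier G" "b \<in> carrier G"
  shows "H #> a = H #> b \<longleftrightarrow> a \<otimes> inv b \<in> H"
  using assms by (metis coset_mult_inv1 coset_mult_inv2 coset_join1 coset_join2 inv_closed m_closed
      subgroup_axioms subset)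

lemma (in normal) rcos_commute_iff:
  assumes "a \<in> carrier G" "b \<in> carrier G"
  shows "(H #> a) \<otimes>\<^bsub>G Mod H\<^esub> (H #> b) = (H #> b) \<otimes>\<^bsub>G Mod H\<^esub> (H #> a)
    \<longleftrightarrow> commutator a b \<in> H"
  using assms by (simp add: rcos_sum rcos_eq_iff commutator_def word_simps)

lemma (in normal) p_elements_Mod:
  assumes "x \<in> p_elements p G"
  shows "H #> x \<in> p_elements p (G Mod H)"
proof -
  obtain k where k: "x \<in> carrier G" "x [^] (p ^ k) = \<one>"
    using assms unfolding p_elements_def by blast
  then have "(H #> x) [^]\<^bsub>G Mod H\<^esub> (p ^ k) = \<one>\<^bsub>G Mod H\<^esub>"
    by (simp add: FactGroup_pow coset_mult_one subset)
  then show ?thesis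
    using k unfolding p_elements_def by (auto simp: carrier_FactGroup)
qed

lemma (in normal) FactGroup_primary_commuting_commutator:
  assumes "primary_commuting (G Mod H)" "prime p" "prime q" "p \<noteq> q"
    and "x \<in> p_elements p G" "y \<in> p_elements q G"
  shows "commutator x y \<in> H"
  using assms rcos_commute_iff p_elements_Mod p_elements_closed
  unfolding primary_commuting_def by meson

lemma (in group) upper_central_Suc_iff:
  "x \<in> upper_central G (Suc i) \<longleftrightarrow>
    x \<in> carrier G \<and> (\<forall>g \<in> carrier G. commutator x g \<in> upper_central G i)"
proof -
  interpret N: normal "upper_central G i" G by (fact upper_central_normal)
  have "x \<in> upper_central G (Suc i) \<longleftrightarrow> x \<in> carrier G \<and>
      (\<forall>g \<in> carrier G. (upper_central G i #> x) \<otimes>\<^bsub>G Mod upper_central G i\<^esub> (upper_central G i #> g)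
        = (upper_central G i #> g) \<otimes>\<^bsub>G Mod upper_central G i\<^esub> (upper_central G i #> x))"
    by (auto simp: group_center_def carrier_FactGroup)
  then show ?thesis using N.rcos_commute_iff by blast
qed

text \<open>If the commutator of \<open>x\<close> and \<open>y\<close> lies in a term of the upper central series, then it
  is central modulo the preceding term, and \<open>central_commutator_trivial\<close> puts it into that term. So
  it descends along the whole series down to the trivial group.\<close>

lemma (in group) hypercenter_p_elements_commute:
  assumes "prime p" "prime q" "p \<noteq> q"
    and x: "x \<in> p_elements p G" "x \<in> hypercenter G" and y: "y \<in> p_elements q G"
  shows "x \<otimes> y = y \<otimes> x"
proof -
  have xG: "x \<in> carrier G" and yG: "y \<in> carrier G"
    using x y p_elements_closed by auto
  obtain k l where k: "x [^] (p ^ k) = \<one>" and l: "y [^] (q ^ l) = \<one>"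
    using x y unfolding p_elements_def by blast
  have "commutator x y \<in> upper_central G 0" if "commutator x y \<in> upper_central G n" for n
    using that
  proof (induction n)
    case (Suc n)
    let ?N = "upper_central G n" and ?Q = "G Mod upper_central G n"
    interpret N: normal ?N G by (fact upper_central_normal)
    interpret Q: group ?Q by (fact N.factorgroup_is_group)
    interpret h: group_hom G ?Q "\<lambda>x. ?N #> x"
      by unfold_locales (fact N.r_coset_hom_Mod)
    have hc: "Q.commutator (?N #> x) (?N #> y) = ?N #> commutator x y"
      using xG yG by (simp add: commutator_def Q.commutator_def del: mult_FactGroup)
    have cen: "(?N #> commutator x y) \<otimes>\<^bsub>?Q\<^esub> (?N #> g) = (?N #> g) \<otimes>\<^bsub>?Q\<^esub> (?N #> commutator x y)"
      if "g \<in> carrier G" for g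
      using Suc.prems that N.rcos_commute_iff upper_central_Suc_iff by blast
    have "(?N #> x) \<otimes>\<^bsub>?Q\<^esub> (?N #> y) = (?N #> y) \<otimes>\<^bsub>?Q\<^esub> (?N #> x)"
    proof (rule Q.central_commutator_trivial)
      show "(?N #> x) [^]\<^bsub>?Q\<^esub> (p ^ k) = \<one>\<^bsub>?Q\<^esub>"
        using xG k h.hom_one by (simp add: N.FactGroup_pow del: h.hom_one one_FactGroup)
      show "(?N #> y) [^]\<^bsub>?Q\<^esub> (q ^ l) = \<one>\<^bsub>?Q\<^esub>"
        using yG l h.hom_one by (simp add: N.FactGroup_pow del: h.hom_one one_FactGroup)
      show "coprime (p ^ k) (q ^ l)"
        using assms by (rule_tac coprime_prime_powers)
    qed (use xG yG cen h.hom_closed in \<open>simp_all add: hc del: mult_FactGroup\<close>)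
    then show ?case
      using N.rcos_commute_iff[OF xG yG] Suc.IH by blast
  qed
  moreover obtain i where "x \<in> upper_central G i"
    using x unfolding hypercenter_def by blast
  then have "x \<in> upper_central G (Suc i)"
    using upper_central_mono by blast
  then have "commutator x y \<in> upper_central G i"
    using yG upper_central_Suc_iff by blast
  ultimately have "commutator x y = \<one>" by auto
  then show ?thesis
    using xG yG commutator_eq_one_iff by blast
qed

lemma (in group) nilpotent_imp_primary_commuting:
  assumes "nilpotent_group G"
  shows "primary_commuting G"
  unfolding primary_commuting_def
  using assms hypercenter_p_elements_commute p_elements_closed
  unfolding nilpotent_group_def hypercenter_def by blast

text \<open>The first term of the upper central series that is not contained in \<open>S\<close> supplies the
  element. Applied to a proper subgroup \<open>S\<close> this is the normalizer condition; applied to a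
  subgroup \<open>S\<close> that is normal in a larger group it yields central elements of a quotient.\<close>

lemma (in group) nilpotent_relative_center:
  assumes "nilpotent_group G" "\<one> \<in> S" "\<not> carrier G \<subseteq> S"
  shows "\<exists>z \<in> carrier G - S. \<forall>g \<in> carrier G. commutator z g \<in> S"
proof -
  obtain n where n: "upper_central G n = carrier G"
    using assms unfolding nilpotent_group_def by blast
  define i where "i = (LEAST i. \<not> upper_central G i \<subseteq> S)"
  have i: "\<not> upper_central G i \<subseteq> S"
    unfolding i_def using n assms(3) by (metis (mono_tags, lifting) LeastI)
  with assms(2) have "i \<noteq> 0" by (metis empty_subsetI insert_subset upper_central.simps(1))
  then obtain j where j: "i = Suc j" using not0_implies_Suc by blast
  then have "upper_central G j \<subseteq> S"
    unfolding i_def using not_less_Least by (metis i_def lessI)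
  with i j show ?thesis
    by (meson DiffI subset_iff upper_central_Suc_iff)
qed

section \<open>Finite groups of prime power order\<close>

text \<open>The class equation: conjugacy classes have \<open>p\<close>-power size, and if the identity were the
  only central element, then all classes but one would have size divisible by \<open>p\<close>, while
  \<open>p\<close> divides the order of the group.\<close>

lemma (in group) p_group_center_nontrivial:
  assumes fin: "finite (carrier G)" and p: "prime p" and ord: "order G = p ^ k" and "k > 0"
  shows "group_center G \<noteq> {\<one>}"
proof
  assume triv: "group_center G = {\<one>}"
  define \<phi> where "\<phi> = (\<lambda>g. \<lambda>h \<in> carrier G. g \<otimes> h \<otimes> inv g)"
  interpret action: group_action G "carrier G" \<phi>
    unfolding \<phi>_def by (fact action_by_conjugation)
  let ?O = "orbits G (carrier G) \<phi>"
  have one: "orbit G \<phi> \<one> = {\<one>}"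
    unfolding orbit_def \<phi>_def using one_closed by (auto intro!: exI[of _ "\<one>"])
  then have one_in: "{\<one>} \<in> ?O"
    unfolding orbits_def by blast
  have "finite ?O"
    unfolding orbits_def Setcompr_eq_image using fin by (rule finite_imageI)
  have dvd: "p dvd card A" if A: "A \<in> ?O - {{\<one>}}" for A
  proof -
    obtain x where x: "x \<in> carrier G" "A = orbit G \<phi> x"
      using A unfolding orbits_def by auto
    have "card A dvd p ^ k"
      using action.orbit_stabilizer_theorem[OF x(1)] x(2) ord by (metis dvd_triv_left)
    then obtain j where j: "card A = p ^ j"
      using divides_primepow_nat[OF p] by blast
    have "card A \<noteq> 1"
    proof
      assume "card A = 1"
      moreover have "x \<in> A"
        using x action.orbit_refl by simp
      ultimately have "A = {x}"
        by (metis card_1_singletonE singletonD)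
      have "g \<otimes> x = x \<otimes> g" if g: "g \<in> carrier G" for g
      proof -
        have "g \<otimes> x \<otimes> inv g \<in> A"
          using g x unfolding x(2) orbit_def \<phi>_def by auto
        then have "g \<otimes> x \<otimes> inv g = x"
          using \<open>A = {x}\<close> by simp
        then show ?thesis
          using g x(1) by (metis inv_solve_right' m_closed)
      qed
      then have "x \<in> group_center G"
        using x(1) unfolding group_center_def by auto
      then have "A = {\<one>}"
        using triv \<open>A = {x}\<close> by simp
      then show False using A by blast
    qed
    then show ?thesis
      using j by (cases j) auto
  qed
  have "order G = (\<Sum>A\<in>?O. card A)"
    using action.disjoint_sum[OF fin, of "\<lambda>_. 1::nat"] by (simp add: order_def)
  also have "\<dots> = 1 + (\<Sum>A\<in>?O - {{\<one>}}. card A)"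
    using sum.remove[OF \<open>finite ?O\<close> one_in, of card] by simp
  finally have "p ^ k = 1 + (\<Sum>A\<in>?O - {{\<one>}}. card A)"
    using ord by simp
  moreover have "p dvd (\<Sum>A\<in>?O - {{\<one>}}. card A)"
    using dvd by (rule dvd_sum)
  moreover have "p dvd p ^ k"
    using \<open>k > 0\<close> by simp
  ultimately have "p dvd 1"
    by (metis dvd_add_left_iff)
  then show False
    using p not_prime_unit by blast
qed

lemma (in group) nilpotent_if_quotient_centers_nontrivial:
  assumes fin: "finite (carrier G)"
    and cen: "\<And>N. \<lbrakk>N \<lhd> G; N \<noteq> carrier G\<rbrakk> \<Longrightarrow> group_center (G Mod N) \<noteq> {\<one>\<^bsub>G Mod N\<^esub>}"
  shows "nilpotent_group G"
proof (rule ccontr)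
  assume not_nilp: "\<not> nilpotent_group G"
  obtain n where n: "upper_central G (Suc n) = upper_central G n"
    using hypercenter_eq_upper_central[OF fin] by (metis le_SucI order_refl)
  let ?N = "upper_central G n"
  interpret N: normal ?N G by (fact upper_central_normal)
  interpret Q: group "G Mod ?N" by (fact N.factorgroup_is_group)
  have "?N \<noteq> carrier G"
    using not_nilp unfolding nilpotent_group_def by blast
  then have "group_center (G Mod ?N) \<noteq> {?N}"
    using cen[OF upper_central_normal] by simp
  moreover have "?N \<in> group_center (G Mod ?N)"
    using normal_imp_subgroup[OF Q.group_center_normal] subgroup.one_closed by force
  ultimately obtain A where A: "A \<in> group_center (G Mod ?N)" "A \<noteq> ?N"
    by blast
  then obtain x where x: "x \<in> carrier G" "A = ?N #> x"
    unfolding group_center_def carrier_FactGroup by blast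
  then have "x \<in> upper_central G (Suc n)"
    using A by simp
  then have "A = ?N"
    unfolding n using x N.rcos_const by blast
  then show False using A by blast
qed

lemma (in group) p_group_nilpotent:
  assumes fin: "finite (carrier G)" and p: "prime p" and ord: "order G = p ^ k"
  shows "nilpotent_group G"
proof (rule nilpotent_if_quotient_centers_nontrivial[OF fin])
  fix N assume N: "N \<lhd> G" "N \<noteq> carrier G"
  interpret N: normal N G by fact
  interpret Q: group "G Mod N" by (fact N.factorgroup_is_group)
  have lag: "order (G Mod N) * card N = p ^ k"
    using lagrange[OF N.subgroup_axioms] ord by (simp add: order_def FactGroup_def)
  then have "order (G Mod N) dvd p ^ k"
    by (metis dvd_triv_left)
  then obtain j where j: "order (G Mod N) = p ^ j"
    using divides_primepow_nat[OF p] by blast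
  have "j \<noteq> 0"
  proof
    assume "j = 0"
    then have "card N = card (carrier G)"
      using lag j ord by (simp add: order_def)
    then show False
      using N fin N.subset card_subset_eq by blast
  qed
  moreover have "finite (carrier (G Mod N))"
    using fin by (simp add: carrier_FactGroup)
  ultimately show "group_center (G Mod N) \<noteq> {\<one>\<^bsub>G Mod N\<^esub>}"
    using Q.p_group_center_nontrivial[OF _ p j] by blast
qed

section \<open>Sylow subgroups and the elementwise form of nilpotency\<close>

definition sylow_subgroup :: "nat \<Rightarrow> 'a set \<Rightarrow> ('a, 'b) monoid_scheme \<Rightarrow> bool"
  where "sylow_subgroup p P G \<longleftrightarrow> subgroup P G \<and> card P = p ^ multiplicity p (order G)"

lemma (in group) sylow_subgroup_exists:
  assumes "finite (carrier G)" "prime p"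
  shows "\<exists>P. sylow_subgroup p P G"
proof -
  have "order G \<noteq> 0"
    using assms(1) one_closed unfolding order_def by auto
  then obtain m where "order G = p ^ multiplicity p (order G) * m"
    using multiplicity_dvd by blast
  from sylow_thm[OF assms(2) group_axioms this assms(1)] show ?thesis
    unfolding sylow_subgroup_def .
qed

lemma (in group) subgroup_pow_card:
  assumes "finite (carrier G)" "subgroup H G" "x \<in> H"
  shows "x [^] card H = \<one>"
proof -
  interpret H: group "G\<lparr>carrier := H\<rparr>" using assms(2) by (rule subgroup_imp_group)
  have "x [^]\<^bsub>G\<lparr>carrier := H\<rparr>\<^esub> order (G\<lparr>carrier := H\<rparr>) = \<one>\<^bsub>G\<lparr>carrier := H\<rparr>\<^esub>"
    using assms by (intro H.pow_order_eq_1) simp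
  then show ?thesis
    by (simp add: order_def nat_pow_def)
qed

lemma (in group) sylow_subgroup_p_elements:
  assumes "finite (carrier G)" "sylow_subgroup p P G"
  shows "P \<subseteq> p_elements p G"
proof
  fix x assume x: "x \<in> P"
  have P: "subgroup P G" "card P = p ^ multiplicity p (order G)"
    using assms(2) unfolding sylow_subgroup_def by auto
  then show "x \<in> p_elements p G"
    using subgroup_pow_card[OF assms(1) P(1) x] subgroup.mem_carrier[OF P(1) x]
    unfolding p_elements_def by auto
qed

text \<open>The order of such a subgroup is divisible by the full \<open>p\<close>-part of the group order for
  every prime \<open>p\<close>.\<close>

lemma (in group) subgroup_containing_sylows:
  assumes fin: "finite (carrier G)" and H: "subgroup H G"
    and sylows: "\<And>p. prime p \<Longrightarrow> \<exists>P. sylow_subgroup p P G \<and> P \<subseteq> H"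
  shows "H = carrier G"
proof -
  interpret H: group "G\<lparr>carrier := H\<rparr>" using H by (rule subgroup_imp_group)
  have HG: "H \<subseteq> carrier G" using H by (rule subgroup.subset)
  have "finite H" using fin HG by (rule finite_subset[rotated])
  then have nz: "order G \<noteq> 0" "card H \<noteq> 0"
    using fin subgroup.one_closed[OF H] one_closed unfolding order_def by auto
  have "order G dvd card H"
  proof (rule multiplicity_le_imp_dvd[OF nz(1)])
    fix p :: nat assume p: "prime p"
    obtain P where P: "sylow_subgroup p P G" "P \<subseteq> H"
      using sylows[OF p] by blast
    then have "subgroup P (G\<lparr>carrier := H\<rparr>)"
      using H subgroup_incl unfolding sylow_subgroup_def by blast
    from H.lagrange[OF this] have "card P dvd card H"
      by (simp add: order_def) (metis dvd_triv_right)
    then show "multiplicity p (order G) \<le> multiplicity p (card H)"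
      using P(1) p nz(2) unfolding sylow_subgroup_def
      by (intro multiplicity_geI) (auto dest: prime_gt_1_nat)
  qed
  then have "card (carrier G) \<le> card H"
    using nz by (simp add: order_def dvd_imp_le)
  then show ?thesis
    using fin HG card_seteq by blast
qed

lemma (in group) normalizer_iff:
  assumes "H \<subseteq> carrier G"
  shows "g \<in> normalizer G H \<longleftrightarrow> g \<in> carrier G \<and> g <# H #> inv g = H"
  using assms by (auto simp: normalizer_def stabilizer_def)

lemma (in group) conj_set_eq:
  "g <# H #> inv g = (\<lambda>x. g \<otimes> x \<otimes> inv g) ` H"
  by (auto simp: l_coset_def r_coset_def)

text \<open>The normalizer of \<open>P\<close> contains \<open>P\<close>, and it contains all Sylow subgroups for other
  primes because these centralize \<open>P\<close>.\<close>

lemma (in group) primary_commuting_sylow_normal: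
  assumes fin: "finite (carrier G)" and comm: "primary_commuting G" and p: "prime p"
    and P: "sylow_subgroup p P G"
  shows "P \<lhd> G"
proof -
  have sP: "subgroup P G" using P unfolding sylow_subgroup_def by blast
  then have PG: "P \<subseteq> carrier G" by (rule subgroup.subset)
  let ?K = "normalizer G P"
  have K: "subgroup ?K G"
    using normalizer_imp_subgroup[OF PG] .
  have "?K = carrier G"
  proof (rule subgroup_containing_sylows[OF fin K])
    fix q :: nat assume q: "prime q"
    show "\<exists>Q. sylow_subgroup q Q G \<and> Q \<subseteq> ?K"
    proof (cases "q = p")
      case True
      have "g <# P #> inv g = P" if "g \<in> P" for g
      proof -
        have g: "g \<in> carrier G" "inv g \<in> P"
          using that sP PG subgroup.m_inv_closed by auto
        then have "g <# P = P" "P #> inv g = P"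
          using coset_join3[OF g(1) sP that] coset_join2[OF _ sP g(2)] by simp_all
        then show ?thesis by simp
      qed
      then have "P \<subseteq> ?K"
        using PG normalizer_iff by blast
      then show ?thesis using P True by blast
    next
      case False
      obtain Q where Q: "sylow_subgroup q Q G"
        using sylow_subgroup_exists[OF fin q] by blast
      have "g <# P #> inv g = P" if g: "g \<in> Q" for g
      proof -
        have gq: "g \<in> p_elements q G"
          using g sylow_subgroup_p_elements[OF fin Q] by blast
        have gx: "g \<otimes> x \<otimes> inv g = x" if "x \<in> P" for x
        proof -
          have "x \<in> p_elements p G"
            using that sylow_subgroup_p_elements[OF fin P] by blast
          with gq have "g \<otimes> x = x \<otimes> g"
            using comm p q False unfolding primary_commuting_def by metis
          then show ?thesis
            using gq that PG by (simp add: p_elements_def m_assoc subsetD)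
        qed
        show ?thesis
          unfolding conj_set_eq using gx by force
      qed
      moreover have "Q \<subseteq> carrier G"
        using Q subgroup.subset unfolding sylow_subgroup_def by blast
      ultimately have "Q \<subseteq> ?K"
        using normalizer_iff[OF PG] by blast
      then show ?thesis using Q by blast
    qed
  qed
  then have "g <# P #> inv g = P" if "g \<in> carrier G" for g
    using that normalizer_iff[OF PG] by blast
  then show ?thesis
    using sP unfolding conj_set_eq by (intro normal_invI) blast+
qed

text \<open>The image of a \<open>p\<close>-element in the quotient by \<open>P\<close> is a \<open>p\<close>-element of a group of
  order prime to \<open>p\<close>.\<close>

lemma (in group) normal_sylow_eq_p_elements:
  assumes fin: "finite (carrier G)" and p: "prime p"
    and P: "sylow_subgroup p P G" "P \<lhd> G"
  shows "P = p_elements p G"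
proof
  show "P \<subseteq> p_elements p G" using sylow_subgroup_p_elements[OF fin P(1)] .
  interpret P: normal P G by (fact P(2))
  interpret Q: group "G Mod P" by (fact P.factorgroup_is_group)
  have lag: "order (G Mod P) * p ^ multiplicity p (order G) = order G"
    using lagrange[OF P.subgroup_axioms] P(1) by (simp add: order_def FactGroup_def sylow_subgroup_def)
  have nz: "order G \<noteq> 0"
    using fin one_closed unfolding order_def by auto
  have "\<not> p dvd order (G Mod P)"
  proof
    assume "p dvd order (G Mod P)"
    then have "p * p ^ multiplicity p (order G) dvd order G"
      using lag by (metis dvd_refl mult_dvd_mono)
    then show False
      using nz p multiplicity_geI[of "order G" p "Suc (multiplicity p (order G))"]
        prime_gt_1_nat[OF p] by simp
  qed
  then have cop: "coprime (order (G Mod P)) (p ^ k)" for k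
    using prime_imp_coprime[OF p] by (metis coprime_commute coprime_power_right_iff)
  show "p_elements p G \<subseteq> P"
  proof
    fix x assume x: "x \<in> p_elements p G"
    then have xG: "x \<in> carrier G" by (rule p_elements_closed)
    have "P #> x \<in> p_elements p (G Mod P)"
      using x by (rule P.p_elements_Mod)
    then obtain k where k: "P #> x \<in> carrier (G Mod P)"
        "(P #> x) [^]\<^bsub>G Mod P\<^esub> (p ^ k) = \<one>\<^bsub>G Mod P\<^esub>"
      unfolding p_elements_def by blast
    have "P #> x = \<one>\<^bsub>G Mod P\<^esub>"
      using Q.coprime_pow_eq_one[OF k(1) _ k(2) cop] k(1) fin Q.pow_order_eq_1
      by (simp add: carrier_FactGroup)
    then have "P #> x = P" by simp
    then show "x \<in> P"
      using coset_join1 P.subgroup_axioms P.subset xG by blast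
  qed
qed

lemma (in group) primary_commuting_p_elements_normal:
  assumes "finite (carrier G)" "primary_commuting G" "prime p"
  shows "p_elements p G \<lhd> G"
proof -
  obtain P where P: "sylow_subgroup p P G"
    using sylow_subgroup_exists assms by blast
  then have "P \<lhd> G"
    using primary_commuting_sylow_normal assms by blast
  then show ?thesis
    using normal_sylow_eq_p_elements[OF assms(1,3) P] by simp
qed

lemma (in group) commutator_preimage_subgroup:
  assumes N: "N \<lhd> G" and z: "z \<in> carrier G"
  shows "subgroup {g \<in> carrier G. commutator z g \<in> N} G"
proof (rule subgroupI)
  interpret N: normal N G by (fact N)
  show "{g \<in> carrier G. commutator z g \<in> N} \<noteq> {}"
    using z N.one_closed by (auto simp: commutator_def intro!: exI[of _ \<one>])
  fix g assume "g \<in> {g \<in> carrier G. commutator z g \<in> N}"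
  then have g: "g \<in> carrier G" "commutator z g \<in> N" by auto
  have "inv g \<otimes> inv (commutator z g) \<otimes> g \<in> N"
    using g N.inv_op_closed1 N.m_inv_closed by blast
  moreover have "inv g \<otimes> inv (commutator z g) \<otimes> g = commutator z (inv g)"
    using g z by (simp add: commutator_def word_simps)
  ultimately show "inv g \<in> {g \<in> carrier G. commutator z g \<in> N}"
    using g by simp
  fix h assume "h \<in> {g \<in> carrier G. commutator z g \<in> N}"
  then have h: "h \<in> carrier G" "commutator z h \<in> N" by auto
  have "commutator z g \<otimes> (g \<otimes> commutator z h \<otimes> inv g) \<in> N"
    using g h N.inv_op_closed2 N.m_closed by blast
  moreover have "commutator z g \<otimes> (g \<otimes> commutator z h \<otimes> inv g) = commutator z (g \<otimes> h)"
    using g h z by (simp add: commutator_def word_simps)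
  ultimately show "g \<otimes> h \<in> {g \<in> carrier G. commutator z g \<in> N}"
    using g h by simp
qed auto

text \<open>Suppose the last term \<open>Z\<close> of the upper central series is proper. Some Sylow subgroup
  \<open>P\<close> is not contained in \<open>Z\<close>. As \<open>P\<close> is nilpotent, it has an element \<open>z\<close> outside \<open>Z\<close>
  whose commutators with \<open>P\<close> lie in \<open>Z\<close>, and the commutators of \<open>z\<close> with Sylow subgroups for
  other primes are trivial. So \<open>z\<close> is central modulo \<open>Z\<close>, and the series does not stop at
  \<open>Z\<close>.\<close>

theorem (in group) primary_commuting_imp_nilpotent:
  assumes fin: "finite (carrier G)" and comm: "primary_commuting G"
  shows "nilpotent_group G"
proof (rule ccontr)
  assume not_nilp: "\<not> nilpotent_group G"
  obtain n where n: "upper_central G (Suc n) = upper_central G n"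
    using hypercenter_eq_upper_central[OF fin] by (metis le_SucI order_refl)
  let ?Z = "upper_central G n"
  interpret Z: normal ?Z G by (fact upper_central_normal)
  have "?Z \<noteq> carrier G"
    using not_nilp unfolding nilpotent_group_def by blast
  then obtain p where p: "prime p" "\<And>P. sylow_subgroup p P G \<Longrightarrow> \<not> P \<subseteq> ?Z"
    using subgroup_containing_sylows[OF fin Z.subgroup_axioms] by blast
  obtain P where P: "sylow_subgroup p P G"
    using sylow_subgroup_exists[OF fin p(1)] by blast
  then have sP: "subgroup P G" "card P = p ^ multiplicity p (order G)"
    unfolding sylow_subgroup_def by auto
  interpret P: group "G\<lparr>carrier := P\<rparr>" using sP(1) by (rule subgroup_imp_group)
  have "finite P"
    using fin subgroup.subset[OF sP(1)] finite_subset by blast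
  then have "nilpotent_group (G\<lparr>carrier := P\<rparr>)"
    using P.p_group_nilpotent[OF _ p(1), of "multiplicity p (order G)"] sP(2) by (simp add: order_def)
  from P.nilpotent_relative_center[OF this, of ?Z]
  obtain z where z: "z \<in> P" "z \<notin> ?Z" "\<And>g. g \<in> P \<Longrightarrow> commutator z g \<in> ?Z"
    using Z.one_closed p(2)[OF P] commutator_subgroup[OF sP(1)] by auto
  have zp: "z \<in> p_elements p G"
    using z(1) sylow_subgroup_p_elements[OF fin P] by blast
  then have zG: "z \<in> carrier G" by (rule p_elements_closed)
  have "{g \<in> carrier G. commutator z g \<in> ?Z} = carrier G"
  proof (rule subgroup_containing_sylows[OF fin commutator_preimage_subgroup[OF Z.normal_axioms zG]])
    fix q :: nat assume q: "prime q"
    obtain Q where Q: "sylow_subgroup q Q G"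
      using sylow_subgroup_exists[OF fin q] by blast
    show "\<exists>Q. sylow_subgroup q Q G \<and> Q \<subseteq> {g \<in> carrier G. commutator z g \<in> ?Z}"
    proof (cases "q = p")
      case True
      then show ?thesis
        using P z(3) subgroup.subset[OF sP(1)] by blast
    next
      case False
      have "commutator z g \<in> ?Z" if "g \<in> Q" for g
      proof -
        have g: "g \<in> p_elements q G"
          using that sylow_subgroup_p_elements[OF fin Q] by blast
        then have "z \<otimes> g = g \<otimes> z"
          using comm p(1) q False zp unfolding primary_commuting_def by metis
        then have "commutator z g = \<one>"
          using commutator_eq_one_iff zG p_elements_closed[OF g] by blast
        then show ?thesis by simp
      qed
      then show ?thesis
        using Q subgroup.subset unfolding sylow_subgroup_def by blast
    qed
  qed
  then have "z \<in> upper_central G (Suc n)"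
    using zG unfolding upper_central_Suc_iff by blast
  then show False using n z(2) by blast
qed

section \<open>Normalizers and maximal subgroups\<close>

text \<open>This set is the preimage of the center of the quotient by \<open>N\<close>.\<close>

lemma (in group) relative_center_normal:
  assumes N: "N \<lhd> G"
  shows "{z \<in> carrier G. \<forall>g \<in> carrier G. commutator z g \<in> N} \<lhd> G" (is "?Z \<lhd> G")
proof (rule normal_invI)
  interpret N: normal N G by (fact N)
  show "subgroup ?Z G"
  proof (rule subgroupI)
    have "\<one> \<in> ?Z" by (simp add: commutator_def)
    then show "?Z \<noteq> {}" by blast
    fix z assume z: "z \<in> ?Z"
    have "commutator (inv z) g \<in> N" if g: "g \<in> carrier G" for g
    proof -
      have "commutator (inv z) g = inv z \<otimes> inv (commutator z g) \<otimes> z"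
        using z g by (simp add: commutator_def word_simps)
      then show ?thesis
        using z g N.inv_op_closed1 N.m_inv_closed by simp
    qed
    then show "inv z \<in> ?Z" using z by simp
    fix w assume w: "w \<in> ?Z"
    have "commutator (z \<otimes> w) g \<in> N" if g: "g \<in> carrier G" for g
    proof -
      have "commutator (z \<otimes> w) g = (z \<otimes> commutator w g \<otimes> inv z) \<otimes> commutator z g"
        using z w g by (simp add: commutator_def word_simps)
      then show ?thesis
        using z w g N.inv_op_closed2 by simp
    qed
    then show "z \<otimes> w \<in> ?Z" using z w by simp
  qed auto
  fix h z assume h: "h \<in> carrier G" and z: "z \<in> ?Z"
  have "commutator (h \<otimes> z \<otimes> inv h) g \<in> N" if g: "g \<in> carrier G" for g
  proof -
    have "commutator (h \<otimes> z \<otimes> inv h) g = h \<otimes> commutator z (inv h \<otimes> g \<otimes> h) \<otimes> inv h"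
      using z h g by (simp add: commutator_def word_simps)
    then show ?thesis
      using z h g N.inv_op_closed2 by simp
  qed
  then show "h \<otimes> z \<otimes> inv h \<in> ?Z" using h z by simp
qed

lemma (in group) set_mult_normalized_subgroup:
  assumes S: "subgroup S G" and H: "subgroup H G"
    and norm: "\<And>h s. \<lbrakk>h \<in> H; s \<in> S\<rbrakk> \<Longrightarrow> h \<otimes> s \<otimes> inv h \<in> S"
  shows "subgroup (S <#> H) G"
proof (rule subgroupI)
  interpret S: subgroup S G by (fact S)
  interpret H: subgroup H G by (fact H)
  show "S <#> H \<subseteq> carrier G"
    using S.subset H.subset by (rule set_mult_closed)
  show "S <#> H \<noteq> {}"
    using S.one_closed H.one_closed unfolding set_mult_def by blast
  fix a assume "a \<in> S <#> H"
  then obtain s h where a: "s \<in> S" "h \<in> H" "a = s \<otimes> h"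
    unfolding set_mult_def by blast
  have "inv a = (inv h \<otimes> inv s \<otimes> inv (inv h)) \<otimes> inv h"
    using a by (simp add: word_simps)
  moreover have "inv h \<otimes> inv s \<otimes> inv (inv h) \<in> S"
    using a norm by blast
  ultimately show "inv a \<in> S <#> H"
    using a unfolding set_mult_def by blast
  fix b assume "b \<in> S <#> H"
  then obtain t k where b: "t \<in> S" "k \<in> H" "b = t \<otimes> k"
    unfolding set_mult_def by blast
  have "a \<otimes> b = (s \<otimes> (h \<otimes> t \<otimes> inv h)) \<otimes> (h \<otimes> k)"
    using a b by (simp add: word_simps)
  moreover have "s \<otimes> (h \<otimes> t \<otimes> inv h) \<in> S" "h \<otimes> k \<in> H"
    using a b norm by auto
  ultimately show "a \<otimes> b \<in> S <#> H"
    unfolding set_mult_def by blast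
qed

lemma (in group) set_mult_factors_subset:
  assumes "subgroup S G" "subgroup H G"
  shows "S \<subseteq> S <#> H" "H \<subseteq> S <#> H"
proof -
  interpret S: subgroup S G by (fact assms)
  interpret H: subgroup H G by (fact assms)
  have "s \<otimes> \<one> \<in> S <#> H" if "s \<in> S" for s
    using that H.one_closed unfolding set_mult_def by blast
  then show "S \<subseteq> S <#> H" by auto
  have "\<one> \<otimes> h \<in> S <#> H" if "h \<in> H" for h
    using that S.one_closed unfolding set_mult_def by blast
  then show "H \<subseteq> S <#> H" by auto
qed

text \<open>Mapping \<open>H\<close> into itself suffices, because conjugation is injective and \<open>H\<close> is finite.\<close>

lemma (in group) normalizerI:
  assumes fin: "finite (carrier G)" and H: "H \<subseteq> carrier G" and g: "g \<in> carrier G"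
    and "\<And>x. x \<in> H \<Longrightarrow> g \<otimes> x \<otimes> inv g \<in> H"
  shows "g \<in> normalizer G H"
proof -
  have "inj_on (\<lambda>x. g \<otimes> x \<otimes> inv g) H"
    using g H by (auto simp: inj_on_def subset_iff)
  moreover have "finite H" using fin H by (rule finite_subset[rotated])
  ultimately have "(\<lambda>x. g \<otimes> x \<otimes> inv g) ` H = H"
    using assms(4) by (intro endo_inj_surj) auto
  then show ?thesis
    using normalizer_iff[OF H] g by (simp add: conj_set_eq)
qed

lemma (in group) normal_if_normalizer_eq_carrier:
  assumes "subgroup H G" "normalizer G H = carrier G"
  shows "H \<lhd> G"
proof (rule normal_invI[OF assms(1)])
  fix g h assume "g \<in> carrier G" "h \<in> H"
  then have "(\<lambda>x. g \<otimes> x \<otimes> inv g) ` H = H"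
    using normalizer_iff[OF subgroup.subset[OF assms(1)], of g] assms(2) by (simp add: conj_set_eq)
  then show "g \<otimes> h \<otimes> inv g \<in> H"
    using \<open>h \<in> H\<close> by blast
qed

definition maximal_subgroup :: "'a set \<Rightarrow> ('a, 'b) monoid_scheme \<Rightarrow> bool"
  where "maximal_subgroup M G \<longleftrightarrow> subgroup M G \<and> M \<noteq> carrier G \<and>
    (\<forall>K. subgroup K G \<longrightarrow> M \<subseteq> K \<longrightarrow> K = M \<or> K = carrier G)"

lemma (in group) subgroup_of_maximal_subgroup:
  assumes fin: "finite (carrier G)" and H: "subgroup H G" "H \<noteq> carrier G"
  shows "\<exists>M. maximal_subgroup M G \<and> H \<subseteq> M"
proof -
  let ?A = "{K. subgroup K G \<and> K \<noteq> carrier G}"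
  have "?A \<subseteq> Pow (carrier G)"
    using subgroup.subset by blast
  then have "finite ?A"
    using fin by (simp add: finite_subset)
  from finite_has_maximal2[OF this, of H] H
  obtain M where "M \<in> ?A" "H \<subseteq> M" "\<forall>K \<in> ?A. M \<subseteq> K \<longrightarrow> M = K"
    by auto
  then show ?thesis
    unfolding maximal_subgroup_def by blast
qed

lemma (in group) conj_subgroup:
  assumes "g \<in> carrier G" "subgroup H G"
  shows "subgroup ((\<lambda>x. g \<otimes> x \<otimes> inv g) ` H) G"
proof (rule subgroupI)
  interpret H: subgroup H G by fact
  show "(\<lambda>x. g \<otimes> x \<otimes> inv g) ` H \<subseteq> carrier G"
    using assms(1) by auto
  show "(\<lambda>x. g \<otimes> x \<otimes> inv g) ` H \<noteq> {}"
    using H.one_closed by blast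
  fix a assume "a \<in> (\<lambda>x. g \<otimes> x \<otimes> inv g) ` H"
  then obtain x where x: "x \<in> H" "a = g \<otimes> x \<otimes> inv g" by blast
  then have "inv a = g \<otimes> inv x \<otimes> inv g"
    using assms(1) by (simp add: word_simps)
  then show "inv a \<in> (\<lambda>x. g \<otimes> x \<otimes> inv g) ` H"
    using x by blast
  fix b assume "b \<in> (\<lambda>x. g \<otimes> x \<otimes> inv g) ` H"
  then obtain y where y: "y \<in> H" "b = g \<otimes> y \<otimes> inv g" by blast
  then have "a \<otimes> b = g \<otimes> (x \<otimes> y) \<otimes> inv g"
    using x assms(1) by (simp add: word_simps)
  then show "a \<otimes> b \<in> (\<lambda>x. g \<otimes> x \<otimes> inv g) ` H"
    using x y by blast
qed

lemma (in group) conj_conj_image: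
  assumes "g \<in> carrier G" "h \<in> carrier G" "H \<subseteq> carrier G"
  shows "(\<lambda>x. h \<otimes> x \<otimes> inv h) ` (\<lambda>x. g \<otimes> x \<otimes> inv g) ` H
    = (\<lambda>x. (h \<otimes> g) \<otimes> x \<otimes> inv (h \<otimes> g)) ` H"
  unfolding image_image using assms by (intro image_cong) (auto simp: word_simps subset_iff)

lemma (in group) conj_one_image:
  assumes "H \<subseteq> carrier G"
  shows "(\<lambda>x. \<one> \<otimes> x \<otimes> inv \<one>) ` H = H"
proof -
  have "(\<lambda>x. \<one> \<otimes> x \<otimes> inv \<one>) ` H = (\<lambda>x. x) ` H"
    using assms by (intro image_cong) auto
  then show ?thesis by simp
qed

lemma (in group) conj_maximal_subgroup:
  assumes g: "g \<in> carrier G" and M: "maximal_subgroup M G"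
  shows "maximal_subgroup ((\<lambda>x. g \<otimes> x \<otimes> inv g) ` M) G"
proof -
  have cancel: "(\<lambda>x. inv g \<otimes> x \<otimes> inv (inv g)) ` (\<lambda>x. g \<otimes> x \<otimes> inv g) ` H = H"
      "(\<lambda>x. g \<otimes> x \<otimes> inv g) ` (\<lambda>x. inv g \<otimes> x \<otimes> inv (inv g)) ` H = H"
    if "H \<subseteq> carrier G" for H
    using conj_conj_image[OF g inv_closed[OF g] that] conj_conj_image[OF inv_closed[OF g] g that]
      conj_one_image[OF that] g by auto
  have sM: "subgroup M G" and MG: "M \<subseteq> carrier G"
    using M subgroup.subset unfolding maximal_subgroup_def by auto
  have sG: "subgroup (carrier G) G" by (rule subgroup_self)
  have full: "(\<lambda>x. h \<otimes> x \<otimes> inv h) ` carrier G = carrier G" if h: "h \<in> carrier G" for h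
  proof
    show "(\<lambda>x. h \<otimes> x \<otimes> inv h) ` carrier G \<subseteq> carrier G" using h by auto
    show "carrier G \<subseteq> (\<lambda>x. h \<otimes> x \<otimes> inv h) ` carrier G"
    proof
      fix y assume y: "y \<in> carrier G"
      have "y = h \<otimes> (inv h \<otimes> y \<otimes> h) \<otimes> inv h"
        using h y by (simp add: word_simps)
      then show "y \<in> (\<lambda>x. h \<otimes> x \<otimes> inv h) ` carrier G"
        using h y by blast
    qed
  qed
  show ?thesis
    unfolding maximal_subgroup_def
  proof (intro conjI allI impI)
    show "subgroup ((\<lambda>x. g \<otimes> x \<otimes> inv g) ` M) G"
      using g sM by (rule conj_subgroup)
    show "(\<lambda>x. g \<otimes> x \<otimes> inv g) ` M \<noteq> carrier G"
      using cancel(1)[OF MG] full[OF inv_closed[OF g]] M unfolding maximal_subgroup_def by force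
    fix K assume K: "subgroup K G" "(\<lambda>x. g \<otimes> x \<otimes> inv g) ` M \<subseteq> K"
    let ?K = "(\<lambda>x. inv g \<otimes> x \<otimes> inv (inv g)) ` K"
    have "subgroup ?K G"
      using inv_closed[OF g] K(1) by (rule conj_subgroup)
    moreover have "M \<subseteq> ?K"
      using image_mono[OF K(2), of "\<lambda>x. inv g \<otimes> x \<otimes> inv (inv g)"] cancel(1)[OF MG] by simp
    ultimately have "?K = M \<or> ?K = carrier G"
      using M unfolding maximal_subgroup_def by blast
    then show "K = (\<lambda>x. g \<otimes> x \<otimes> inv g) ` M \<or> K = carrier G"
      using cancel(2)[OF subgroup.subset[OF K(1)]] full[OF g] by metis
  qed
qed

section \<open>Groups all of whose proper subgroups are nilpotent\<close>

text \<open>Nilpotency appears in its elementwise form, which for finite groups is equivalent and spares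
  the translation of the upper central series between a group and its subgroups.\<close>

locale minimal_non_nilpotent = group +
  assumes finite_carrier: "finite (carrier G)"
    and proper_subgroup_commuting:
      "\<lbrakk>subgroup H G; H \<noteq> carrier G\<rbrakk> \<Longrightarrow> primary_commuting (G\<lparr>carrier := H\<rparr>)"
    and not_commuting: "\<not> primary_commuting G"
begin

lemma proper_relative_center:
  assumes M: "subgroup M G" "M \<noteq> carrier G" and S: "\<one> \<in> S" "\<not> M \<subseteq> S"
  shows "\<exists>z \<in> M - S. \<forall>m \<in> M. commutator z m \<in> S"
proof -
  interpret M: group "G\<lparr>carrier := M\<rparr>" using M(1) by (rule subgroup_imp_group)
  have "finite M"
    using finite_carrier subgroup.subset[OF M(1)] finite_subset by blast
  then have "nilpotent_group (G\<lparr>carrier := M\<rparr>)"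
    using M.primary_commuting_imp_nilpotent proper_subgroup_commuting[OF M] by simp
  from M.nilpotent_relative_center[OF this, of S] show ?thesis
    using S commutator_subgroup[OF M(1)] by auto
qed

lemma not_generated_by_one_element:
  assumes x: "x \<in> carrier G"
  shows "generate G {x} \<noteq> carrier G"
proof
  assume gen: "generate G {x} = carrier G"
  have "a \<otimes> b = b \<otimes> a" if ab: "a \<in> carrier G" "b \<in> carrier G" for a b
  proof -
    have "carrier G = {x [^] k | k. k \<in> (UNIV :: int set)}"
      using gen generate_pow[OF x] by simp
    then obtain i j where "a = x [^] (i::int)" "b = x [^] (j::int)"
      using ab by blast
    then show ?thesis
      using x by (metis add.commute int_pow_mult)
  qed
  then show False
    using not_commuting p_elements_closed unfolding primary_commuting_def by blast
qed

lemma element_of_maximal_subgroup: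
  assumes "x \<in> carrier G"
  shows "\<exists>M. maximal_subgroup M G \<and> x \<in> M"
proof -
  have "subgroup (generate G {x}) G"
    using assms by (intro generate_is_subgroup) simp
  from subgroup_of_maximal_subgroup[OF finite_carrier this not_generated_by_one_element[OF assms]]
  show ?thesis using generate.incl[of x "{x}" G] by blast
qed

end

text \<open>The situation to be excluded: \<open>N\<close> is a maximal proper normal subgroup and the quotient by
  \<open>N\<close> has trivial center. Excluding it amounts to the statement that a minimal non-nilpotent group
  is not perfect.\<close>

locale centerless_quotient = minimal_non_nilpotent +
  fixes N
  assumes N: "N \<lhd> G" "N \<noteq> carrier G"
    and N_max: "\<lbrakk>K \<lhd> G; N \<subseteq> K; K \<noteq> carrier G\<rbrakk> \<Longrightarrow> K = N"
    and centerless: "{z \<in> carrier G. \<forall>g \<in> carrier G. commutator z g \<in> N} = N"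
begin

sublocale N: normal N G by (fact N)

text \<open>If \<open>M\<close> does not contain \<open>N\<close>, then \<open>G = N M\<close>, and the quotient by \<open>N\<close> is an image
  of the nilpotent group \<open>M\<close>. An element of \<open>M\<close> that is central modulo \<open>N\<close> in \<open>M\<close> is then
  central modulo \<open>N\<close> in \<open>G\<close>.\<close>

lemma maximal_subgroup_contains_N:
  assumes M: "maximal_subgroup M G"
  shows "N \<subseteq> M"
proof (rule ccontr)
  assume not_sub: "\<not> N \<subseteq> M"
  have sM: "subgroup M G" "M \<noteq> carrier G"
    and max: "\<And>K. \<lbrakk>subgroup K G; M \<subseteq> K\<rbrakk> \<Longrightarrow> K = M \<or> K = carrier G"
    using M unfolding maximal_subgroup_def by auto
  interpret M: subgroup M G by (fact sM)
  have NM: "N <#> M = carrier G"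
    using max[of "N <#> M"] set_mult_factors_subset[OF N.subgroup_axioms sM(1)] not_sub
      set_mult_normalized_subgroup[OF N.subgroup_axioms sM(1)] N.inv_op_closed2 by auto
  have "\<not> M \<subseteq> N"
    using max[OF N.subgroup_axioms] not_sub N(2) by blast
  then obtain z where z: "z \<in> M" "z \<notin> N" "\<And>m. m \<in> M \<Longrightarrow> commutator z m \<in> N"
    using proper_relative_center[OF sM N.one_closed] by blast
  have zG: "z \<in> carrier G" using z(1) by (rule M.mem_carrier)
  let ?C = "{g \<in> carrier G. commutator z g \<in> N}"
  interpret C: subgroup ?C G
    using N.normal_axioms zG by (rule commutator_preimage_subgroup)
  have "n \<in> ?C" if "n \<in> N" for n
    using N.m_closed[OF N.inv_op_closed2[OF zG that] N.m_inv_closed[OF that]] N.mem_carrier[OF that]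
    unfolding commutator_def by blast
  moreover have "m \<in> ?C" if "m \<in> M" for m
    using that z(3) M.mem_carrier by blast
  ultimately have "n \<otimes> m \<in> ?C" if "n \<in> N" "m \<in> M" for n m
    using that C.m_closed by blast
  then have "carrier G \<subseteq> ?C"
    unfolding NM[symmetric] set_mult_def by blast
  then have "z \<in> N"
    using zG centerless by blast
  then show False using z(2) by blast
qed

text \<open>Choose a counterexample with maximal intersection \<open>D\<close>. By nilpotency each of the two
  maximal subgroups contains elements outside \<open>D\<close> that normalize \<open>D\<close>. A maximal subgroup
  \<open>M3\<close> containing the normalizer of \<open>D\<close> therefore meets both of them in more than \<open>D\<close>, so by
  the choice of \<open>D\<close> it coincides with both of them.\<close>

lemma maximal_subgroups_intersect_in_N:
  assumes "maximal_subgroup M1 G" "maximal_subgroup M2 G" "M1 \<noteq> M2"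
  shows "M1 \<inter> M2 = N"
proof (rule ccontr)
  assume "M1 \<inter> M2 \<noteq> N"
  let ?A = "{D. D \<noteq> N \<and> (\<exists>M1 M2. maximal_subgroup M1 G \<and> maximal_subgroup M2 G \<and> M1 \<noteq> M2
    \<and> D = M1 \<inter> M2)}"
  have "?A \<subseteq> Pow (carrier G)"
    unfolding maximal_subgroup_def using subgroup.subset by blast
  then have "finite ?A"
    using finite_carrier by (simp add: finite_subset)
  moreover have "M1 \<inter> M2 \<in> ?A"
    using assms \<open>M1 \<inter> M2 \<noteq> N\<close> by blast
  ultimately obtain D where D: "D \<in> ?A" and D_max: "\<And>E. \<lbrakk>E \<in> ?A; D \<subseteq> E\<rbrakk> \<Longrightarrow> D = E"
    using finite_has_maximal[of ?A] by (metis (no_types, lifting) empty_iff)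
  then obtain M1 M2 where M: "maximal_subgroup M1 G" "maximal_subgroup M2 G" "M1 \<noteq> M2"
    and DM: "D = M1 \<inter> M2" and DN: "D \<noteq> N"
    by blast
  have sM: "subgroup M1 G" "subgroup M2 G" "M1 \<noteq> carrier G" "M2 \<noteq> carrier G"
    using M unfolding maximal_subgroup_def by auto
  have sD: "subgroup D G"
    unfolding DM using sM(1,2) by (rule subgroups_Inter_pair)
  then have DG: "D \<subseteq> carrier G" by (rule subgroup.subset)
  have ND: "N \<subseteq> D"
    unfolding DM using M maximal_subgroup_contains_N by blast
  have "D \<noteq> carrier G"
    using DM sM(3) subgroup.subset[OF sM(1)] by blast
  let ?K = "normalizer G D"
  have sK: "subgroup ?K G"
    using DG by (rule normalizer_imp_subgroup)
  have "?K \<noteq> carrier G"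
    using normal_if_normalizer_eq_carrier[OF sD] N_max ND DN \<open>D \<noteq> carrier G\<close> by blast
  then obtain M3 where M3: "maximal_subgroup M3 G" "?K \<subseteq> M3"
    using subgroup_of_maximal_subgroup[OF finite_carrier sK] by blast
  have DK: "D \<subseteq> ?K"
  proof
    fix d assume "d \<in> D"
    then show "d \<in> ?K"
      using sD DG by (intro normalizerI[OF finite_carrier DG])
        (auto intro: subgroup.m_closed subgroup.m_inv_closed)
  qed
  have eq: "M3 = M" if M: "maximal_subgroup M G" "D \<subseteq> M" "\<not> M \<subseteq> D" for M
  proof (rule ccontr)
    assume neq: "M3 \<noteq> M"
    have sM: "subgroup M G" "M \<noteq> carrier G"
      using M unfolding maximal_subgroup_def by auto
    obtain z where z: "z \<in> M" "z \<notin> D" "\<And>m. m \<in> M \<Longrightarrow> commutator z m \<in> D"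
      using proper_relative_center[OF sM subgroup.one_closed[OF sD] M(3)] by blast
    have zG: "z \<in> carrier G"
      using z(1) subgroup.subset[OF sM(1)] by blast
    have "z \<in> ?K"
    proof (rule normalizerI[OF finite_carrier DG zG])
      fix d assume d: "d \<in> D"
      have "z \<otimes> d \<otimes> inv z = commutator z d \<otimes> d"
        using d DG zG by (auto simp: commutator_def word_simps subset_iff)
      then show "z \<otimes> d \<otimes> inv z \<in> D"
        using d M(2) z(3) subgroup.m_closed[OF sD] by auto
    qed
    then have zM: "z \<in> M3 \<inter> M" using M3(2) z(1) by blast
    then have "M3 \<inter> M \<in> ?A"
      using M3(1) M(1) neq ND z(2) by blast
    moreover have "D \<subseteq> M3 \<inter> M"
      using DK M3(2) M(2) by blast
    ultimately have "D = M3 \<inter> M" by (rule D_max)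
    then show False using zM z(2) by blast
  qed
  have "\<not> M1 \<subseteq> D" "\<not> M2 \<subseteq> D"
    using M sM unfolding DM maximal_subgroup_def by blast+
  then have "M3 = M1" "M3 = M2"
    using eq M DM by blast+
  then show False using M(3) by blast
qed

text \<open>Otherwise \<open>N\<close> would be the only maximal subgroup, although every element, in particular
  one outside \<open>N\<close>, lies in some maximal subgroup.\<close>

lemma maximal_subgroup_neq_N:
  assumes M: "maximal_subgroup M G"
  shows "M \<noteq> N"
proof
  assume MN: "M = N"
  obtain x where x: "x \<in> carrier G" "x \<notin> N"
    using N N.subset by blast
  then obtain M' where M': "maximal_subgroup M' G" "x \<in> M'"
    using element_of_maximal_subgroup by blast
  then have "M \<subseteq> M'" "M' \<noteq> M"
    using maximal_subgroup_contains_N MN x by blast+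
  then show False
    using M M'(1) unfolding maximal_subgroup_def by blast
qed

lemma maximal_subgroup_self_normalizing:
  assumes M: "maximal_subgroup M G" and g: "g \<in> carrier G" "(\<lambda>x. g \<otimes> x \<otimes> inv g) ` M = M"
  shows "g \<in> M"
proof -
  have sM: "subgroup M G" "M \<noteq> carrier G"
    using M unfolding maximal_subgroup_def by auto
  then have MG: "M \<subseteq> carrier G" using subgroup.subset by blast
  have "normalizer G M \<noteq> carrier G"
    using normal_if_normalizer_eq_carrier[OF sM(1)] N_max maximal_subgroup_contains_N[OF M]
      maximal_subgroup_neq_N[OF M] sM(2) by blast
  moreover have "M \<subseteq> normalizer G M"
  proof
    fix m assume "m \<in> M"
    then show "m \<in> normalizer G M"
      using sM MG by (intro normalizerI[OF finite_carrier MG])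
        (auto intro: subgroup.m_closed subgroup.m_inv_closed)
  qed
  ultimately have "normalizer G M = M"
    using M normalizer_imp_subgroup[OF MG] unfolding maximal_subgroup_def by blast
  moreover have "g \<in> normalizer G M"
    using g normalizer_iff[OF MG, of g] unfolding conj_set_eq by blast
  ultimately show ?thesis by blast
qed

definition conjugates_outside_N :: "'a set \<Rightarrow> 'a set"
  where "conjugates_outside_N M = (\<lambda>(g, m). g \<otimes> m \<otimes> inv g) ` (carrier G \<times> (M - N))"

text \<open>Count pairs \<open>(g, m)\<close> with \<open>m \<in> M - N\<close> by the value of \<open>g m g\<^sup>-\<^sup>1\<close>. Two pairs with
  the same value put a point outside \<open>N\<close> into two conjugates of \<open>M\<close>, so these conjugates agree and,
  \<open>M\<close> being its own normalizer, the first components differ by an element of \<open>M\<close>. Every value is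
  therefore attained exactly \<open>card M\<close> times.\<close>

lemma card_conjugates_outside_N:
  assumes M: "maximal_subgroup M G"
  shows "card (conjugates_outside_N M) * card M = order G * (card M - card N)"
proof -
  let ?f = "\<lambda>(g, m). g \<otimes> m \<otimes> inv g" and ?S = "carrier G \<times> (M - N)"
  have sM: "subgroup M G" using M unfolding maximal_subgroup_def by blast
  interpret M: subgroup M G by (fact sM)
  have NM: "N \<subseteq> M" using M by (rule maximal_subgroup_contains_N)
  have fM: "finite M" using finite_carrier M.subset by (rule finite_subset[rotated])
  have fS: "finite ?S" using finite_carrier fM by simp
  have fiber: "card {x \<in> ?S. ?f x = y} = card M" if y: "y \<in> ?f ` ?S" for y
  proof -
    obtain g m where gm: "g \<in> carrier G" "m \<in> M" "m \<notin> N" "y = g \<otimes> m \<otimes> inv g"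
      using y by auto
    have mG: "m \<in> carrier G" using gm by simp
    let ?h = "\<lambda>k. (g \<otimes> k, inv k \<otimes> m \<otimes> k)"
    have "{x \<in> ?S. ?f x = y} = ?h ` M"
    proof
      show "?h ` M \<subseteq> {x \<in> ?S. ?f x = y}"
      proof
        fix x assume "x \<in> ?h ` M"
        then obtain k where k: "k \<in> M" "x = ?h k" by blast
        then have kG: "k \<in> carrier G" by simp
        have "inv k \<otimes> m \<otimes> k \<notin> N"
        proof
          assume "inv k \<otimes> m \<otimes> k \<in> N"
          then have "k \<otimes> (inv k \<otimes> m \<otimes> k) \<otimes> inv k \<in> N"
            using N.inv_op_closed2 kG by blast
          then show False
            using kG mG gm(3) by (simp add: word_simps)
        qed
        then show "x \<in> {x \<in> ?S. ?f x = y}"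
          using k kG gm mG by (simp add: word_simps)
      qed
      show "{x \<in> ?S. ?f x = y} \<subseteq> ?h ` M"
      proof
        fix x assume "x \<in> {x \<in> ?S. ?f x = y}"
        then obtain g' m' where x: "x = (g', m')" "g' \<in> carrier G" "m' \<in> M" "m' \<notin> N"
            "g' \<otimes> m' \<otimes> inv g' = g \<otimes> m \<otimes> inv g"
          using gm(4) by auto
        define k where "k = inv g \<otimes> g'"
        have kG: "k \<in> carrier G" and g': "g' = g \<otimes> k"
          unfolding k_def using gm x by simp_all
        have m'G: "m' \<in> carrier G" using x by simp
        have "k \<otimes> m' \<otimes> inv k = inv g \<otimes> (g' \<otimes> m' \<otimes> inv g') \<otimes> g"
          unfolding k_def using gm(1) x(2) m'G by (simp add: word_simps)
        also have "\<dots> = m"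
          unfolding x(5) using gm(1) mG by (simp add: word_simps)
        finally have km: "k \<otimes> m' \<otimes> inv k = m" .
        let ?M' = "(\<lambda>x. k \<otimes> x \<otimes> inv k) ` M"
        have "m \<in> ?M' \<inter> M"
          using km x(3) gm(2) by blast
        then have "?M' = M"
          using maximal_subgroups_intersect_in_N[OF conj_maximal_subgroup[OF kG M] M] gm(3) by blast
        then have "k \<in> M"
          using maximal_subgroup_self_normalizing[OF M kG] by blast
        moreover have "inv k \<otimes> m \<otimes> k = m'"
          unfolding km[symmetric] using kG m'G by (simp add: word_simps)
        ultimately show "x \<in> ?h ` M"
          using x(1) g' by blast
      qed
    qed
    moreover have "inj_on ?h M"
      using gm(1) by (auto simp: inj_on_def)
    ultimately show ?thesis
      by (simp add: card_image)
  qed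
  have "card ?S = (\<Sum>y\<in>?f ` ?S. card {x \<in> ?S. ?f x = y})"
    using sum.image_gen[OF fS, of "\<lambda>_. 1::nat" ?f] by simp
  also have "\<dots> = card (conjugates_outside_N M) * card M"
    unfolding conjugates_outside_N_def using fiber by simp
  finally show ?thesis
    using card_Diff_subset[OF finite_subset[OF NM fM] NM]
    by (simp add: order_def card_cartesian_product)
qed

lemma conjugates_outside_N_disjoint:
  assumes "M \<subseteq> carrier G"
  shows "conjugates_outside_N M \<inter> N = {}"
proof -
  have False if gm: "g \<in> carrier G" "m \<in> M" "m \<notin> N" "g \<otimes> m \<otimes> inv g \<in> N" for g m
  proof -
    have "inv g \<otimes> (g \<otimes> m \<otimes> inv g) \<otimes> g \<in> N"
      using gm N.inv_op_closed1 by blast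
    then show False
      using gm assms by (auto simp: word_simps subset_iff)
  qed
  then show ?thesis unfolding conjugates_outside_N_def by auto
qed

lemma card_maximal_subgroup_ge:
  assumes M: "maximal_subgroup M G"
  shows "2 * card N \<le> card M"
proof -
  have sM: "subgroup M G" using M unfolding maximal_subgroup_def by blast
  interpret M: group "G\<lparr>carrier := M\<rparr>" using sM by (rule subgroup_imp_group)
  have NM: "N \<subseteq> M" using M by (rule maximal_subgroup_contains_N)
  have fM: "finite M" using finite_carrier subgroup.subset[OF sM] by (rule finite_subset[rotated])
  have "subgroup N (G\<lparr>carrier := M\<rparr>)"
    using N.subgroup_axioms sM NM by (rule subgroup_incl)
  from M.lagrange[OF this] have "card N dvd card M"
    by (simp add: order_def) (metis dvd_triv_right)
  then obtain k where k: "card M = k * card N"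
    by (metis dvd_def mult.commute)
  have "card N < card M"
    using psubset_card_mono[OF fM] NM maximal_subgroup_neq_N[OF M] by blast
  then have "k \<noteq> 0" "k \<noteq> 1" using k by auto
  then have "2 \<le> k" by simp
  then show ?thesis
    unfolding k by (rule mult_le_mono1)
qed

text \<open>Outside \<open>N\<close>, the conjugates of one maximal subgroup \<open>M\<close> contain at least half of the
  elements of \<open>G\<close>, but not all elements that lie outside \<open>N\<close>. A maximal subgroup \<open>M'\<close> through a point that is left over
  is not conjugate to \<open>M\<close>, so its conjugates contain another half, disjoint from the first; there
  is no room left for \<open>N\<close>.\<close>

lemma centerless_quotient_absurd: False
proof -
  obtain M where M: "maximal_subgroup M G"
    using element_of_maximal_subgroup[OF one_closed] by blast
  have MG: "M' \<subseteq> carrier G" "finite M'" if "maximal_subgroup M' G" for M'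
  proof -
    show "M' \<subseteq> carrier G"
      using that subgroup.subset unfolding maximal_subgroup_def by blast
    then show "finite M'"
      using finite_carrier by (rule finite_subset)
  qed
  have sub: "conjugates_outside_N M' \<subseteq> carrier G" if "maximal_subgroup M' G" for M'
    using MG(1)[OF that] unfolding conjugates_outside_N_def by auto
  have cN: "card N > 0"
    using N.one_closed finite_subset[OF N.subset finite_carrier] card_gt_0_iff by blast
  have half: "order G \<le> 2 * card (conjugates_outside_N M')" if M': "maximal_subgroup M' G" for M'
  proof -
    have "order G * card M' \<le> order G * (2 * (card M' - card N))"
      using card_maximal_subgroup_ge[OF M'] by (intro mult_le_mono2) simp
    also have "\<dots> = 2 * card (conjugates_outside_N M') * card M'"
      using card_conjugates_outside_N[OF M'] by simp
    finally have "order G * card M' \<le> 2 * card (conjugates_outside_N M') * card M'" .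
    moreover have "card M' > 0"
      using card_maximal_subgroup_ge[OF M'] cN by linarith
    ultimately show ?thesis by simp
  qed
  \<comment> \<open>The exact count of conjugates would make \<open>M\<close> as large as \<open>G\<close>.\<close>
  have "\<not> carrier G \<subseteq> N \<union> conjugates_outside_N M"
  proof
    assume "carrier G \<subseteq> N \<union> conjugates_outside_N M"
    then have "carrier G = N \<union> conjugates_outside_N M"
      using N.subset sub[OF M] by blast
    then have "order G = card N + card (conjugates_outside_N M)"
      using conjugates_outside_N_disjoint[OF MG(1)[OF M]] finite_carrier
      by (simp add: order_def card_Un_disjoint Int_commute)
    then have "order G * card M = card N * card M + order G * (card M - card N)"
      using card_conjugates_outside_N[OF M] by (simp add: add_mult_distrib)
    moreover have "order G * (card M - card N) + order G * card N = order G * card M"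
      using card_maximal_subgroup_ge[OF M] by (simp add: add_mult_distrib2[symmetric])
    ultimately have "order G * card N = card N * card M" by linarith
    then have "order G = card M" using cN by simp
    then show False
      using M card_subset_eq[OF finite_carrier MG(1)[OF M]] unfolding maximal_subgroup_def order_def
      by simp
  qed
  then obtain y where y: "y \<in> carrier G" "y \<notin> N" "y \<notin> conjugates_outside_N M" by blast
  then obtain M' where M': "maximal_subgroup M' G" "y \<in> M'"
    using element_of_maximal_subgroup by blast
  have "conjugates_outside_N M \<inter> conjugates_outside_N M' = {}"
  proof (rule ccontr)
    assume "conjugates_outside_N M \<inter> conjugates_outside_N M' \<noteq> {}"
    then obtain w where w: "w \<in> conjugates_outside_N M" "w \<in> conjugates_outside_N M'" by blast
    then have wN: "w \<notin> N" using conjugates_outside_N_disjoint[OF MG(1)[OF M]] by blast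
    obtain g m g' m' where gm: "g \<in> carrier G" "m \<in> M" "w = g \<otimes> m \<otimes> inv g"
        "g' \<in> carrier G" "m' \<in> M'" "w = g' \<otimes> m' \<otimes> inv g'"
      using w unfolding conjugates_outside_N_def by auto
    let ?c = "\<lambda>g x. g \<otimes> x \<otimes> inv g"
    have "?c g ` M = ?c g' ` M'"
      using maximal_subgroups_intersect_in_N[OF conj_maximal_subgroup[OF gm(1) M]
          conj_maximal_subgroup[OF gm(4) M'(1)]] wN gm by blast
    then have "?c g' y \<in> ?c g ` M" using M'(2) by blast
    then obtain x where x: "x \<in> M" "g' \<otimes> y \<otimes> inv g' = g \<otimes> x \<otimes> inv g" by blast
    have xG: "x \<in> carrier G" using x MG(1)[OF M] by blast
    have "y = inv g' \<otimes> (g' \<otimes> y \<otimes> inv g') \<otimes> g'"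
      using y(1) gm(4) by (simp add: word_simps)
    also have "\<dots> = (inv g' \<otimes> g) \<otimes> x \<otimes> inv (inv g' \<otimes> g)"
      unfolding x(2) using xG gm(1,4) by (simp add: word_simps)
    finally have yx: "y = (inv g' \<otimes> g) \<otimes> x \<otimes> inv (inv g' \<otimes> g)" .
    have "x \<notin> N"
      using yx y(2) N.inv_op_closed2[of "inv g' \<otimes> g" x] gm(1,4) by auto
    then have "y \<in> conjugates_outside_N M"
      unfolding conjugates_outside_N_def using x(1) gm(1,4) yx by (intro image_eqI[of _ _ "(inv g' \<otimes> g, x)"]) auto
    then show False using y(3) by blast
  qed
  moreover have "(conjugates_outside_N M \<union> conjugates_outside_N M') \<inter> N = {}"
    using conjugates_outside_N_disjoint MG M M'(1) by blast
  moreover have fin: "finite (conjugates_outside_N M)" "finite (conjugates_outside_N M')" "finite N"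
    using sub M M'(1) N.subset finite_carrier finite_subset by blast+
  ultimately have "card (conjugates_outside_N M \<union> conjugates_outside_N M' \<union> N) = card (conjugates_outside_N M) + card (conjugates_outside_N M') + card N"
    by (simp add: card_Un_disjoint)
  moreover have "card (conjugates_outside_N M \<union> conjugates_outside_N M' \<union> N) \<le> order G"
    unfolding order_def using sub M M'(1) N.subset finite_carrier by (intro card_mono) auto
  ultimately show False
    using half[OF M] half[OF M'(1)] cN by linarith
qed

end

context minimal_non_nilpotent
begin

text \<open>For a maximal proper normal subgroup \<open>N\<close>, the preimage of the center of the quotient
  is everything or \<open>N\<close>; the second case is the one just excluded.\<close>

lemma normal_subgroup_with_abelian_quotient:
  "\<exists>N. N \<lhd> G \<and> N \<noteq> carrier G \<and> (\<forall>x \<in> carrier G. \<forall>y \<in> carrier G. commutator x y \<in> N)"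
proof -
  let ?A = "{N. N \<lhd> G \<and> N \<noteq> carrier G}"
  have "?A \<subseteq> Pow (carrier G)"
    using normal_imp_subgroup subgroup.subset by blast
  then have fin: "finite ?A"
    using finite_carrier by (simp add: finite_subset)
  have "carrier G \<noteq> {\<one>}"
    using not_commuting p_elements_closed unfolding primary_commuting_def by (metis singletonD)
  then have "{\<one>} \<in> ?A"
    using one_is_normal by auto
  from finite_has_maximal2[OF fin this] obtain N
    where N: "N \<lhd> G" "N \<noteq> carrier G" and max: "\<And>K. \<lbrakk>K \<lhd> G; K \<noteq> carrier G; N \<subseteq> K\<rbrakk> \<Longrightarrow> N = K"
    by auto
  interpret N: normal N G by (fact N)
  let ?Z = "{z \<in> carrier G. \<forall>g \<in> carrier G. commutator z g \<in> N}"
  have "N \<subseteq> ?Z"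
  proof
    fix n assume n: "n \<in> N"
    have "commutator n g \<in> N" if g: "g \<in> carrier G" for g
    proof -
      have "commutator n g = n \<otimes> (g \<otimes> inv n \<otimes> inv g)"
        using n g by (simp add: commutator_def word_simps)
      then show ?thesis
        using n N.inv_op_closed2[OF g, of "inv n"] by simp
    qed
    then show "n \<in> ?Z" using n by simp
  qed
  then have "?Z = carrier G \<or> ?Z = N"
    using max[OF relative_center_normal[OF N(1)]] by blast
  then show ?thesis
  proof
    assume "?Z = carrier G"
    then show ?thesis using N by blast
  next
    assume "?Z = N"
    then interpret centerless_quotient G N
      using N max by unfold_locales blast+
    show ?thesis using centerless_quotient_absurd by blast
  qed
qed

text \<open>If the normal subgroup \<open>N\<close> with abelian quotient contains neither element, take the
  preimage \<open>?K\<close> of the \<open>p\<close>-part of the quotient. It contains \<open>x\<close>; it is proper since it does not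
  contain \<open>y\<close>.\<close>

lemma proper_normal_subgroup_containing:
  assumes p: "prime p" "prime q" "p \<noteq> q" and x: "x \<in> p_elements p G" and y: "y \<in> p_elements q G"
  shows "\<exists>K. K \<lhd> G \<and> K \<noteq> carrier G \<and> (x \<in> K \<or> y \<in> K)"
proof -
  obtain N where N: "N \<lhd> G" "N \<noteq> carrier G"
      and ab: "\<And>x y. \<lbrakk>x \<in> carrier G; y \<in> carrier G\<rbrakk> \<Longrightarrow> commutator x y \<in> N"
    using normal_subgroup_with_abelian_quotient by blast
  interpret N: normal N G by (fact N)
  interpret Q: group "G Mod N" by (fact N.factorgroup_is_group)
  let ?Q = "G Mod N"
  have coset: "N #> g \<in> carrier ?Q" if "g \<in> carrier G" for g
    using that by (auto simp: carrier_FactGroup)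
  have pow_in: "g [^] (n::nat) \<in> N \<longleftrightarrow> (N #> g) [^]\<^bsub>?Q\<^esub> n = \<one>\<^bsub>?Q\<^esub>" if "g \<in> carrier G" for g n
    using that N.FactGroup_pow[OF that, of n] coset_join1 coset_join2
    by (metis N.rcos_const N.subgroup_axioms N.subset nat_pow_closed one_FactGroup)
  show ?thesis
  proof (cases "x \<in> N \<or> y \<in> N")
    case True
    then show ?thesis using N by blast
  next
    case False
    let ?K = "{g \<in> carrier G. \<exists>k. g [^] (p ^ k) \<in> N}"
    obtain k where "x \<in> carrier G" "x [^] (p ^ k) = \<one>"
      using x unfolding p_elements_def by blast
    then have xK: "x \<in> ?K"
      using N.one_closed by (auto intro!: exI[of _ k])
    have "y \<notin> ?K"
    proof
      assume "y \<in> ?K"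
      then obtain k where k: "y \<in> carrier G" "y [^] (p ^ k) \<in> N" by blast
      obtain l where "y [^] (q ^ l) = \<one>"
        using y unfolding p_elements_def by blast
      then have "y [^] (q ^ l) \<in> N"
        using N.one_closed by simp
      then have "N #> y = \<one>\<^bsub>?Q\<^esub>"
        using Q.coprime_pow_eq_one[OF coset[OF k(1)] _ _ coprime_prime_powers[OF p]] k pow_in by blast
      then have "y \<in> N"
        using rcos_self[OF k(1) N.subgroup_axioms] by simp
      then show False using False by simp
    qed
    then have "?K \<noteq> carrier G"
      using y p_elements_closed by blast
    moreover have "?K \<lhd> G"
    proof (rule normal_invI)
      show "subgroup ?K G"
      proof (rule subgroupI)
        show "?K \<noteq> {}" using xK by blast
        fix a assume a: "a \<in> ?K"
        then obtain k where k: "a \<in> carrier G" "a [^] (p ^ k) \<in> N" by blast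
        then have "inv a [^] (p ^ k) \<in> N"
          using N.m_inv_closed by (simp add: nat_pow_inv)
        then show "inv a \<in> ?K" using k by blast
        fix b assume "b \<in> ?K"
        then obtain l where l: "b \<in> carrier G" "b [^] (p ^ l) \<in> N" by blast
        let ?n = "p ^ k * p ^ l"
        have "a [^] ?n \<in> N"
          using k N.subgroup_axioms nat_pow_pow[OF k(1), of "p ^ k" "p ^ l"]
          by (metis N.rcos_const Q.nat_pow_one coset_join2 one_FactGroup pow_in nat_pow_closed)
        moreover have "b [^] ?n \<in> N"
          using l N.subgroup_axioms nat_pow_pow[OF l(1), of "p ^ l" "p ^ k"]
          by (metis N.rcos_const Q.nat_pow_one coset_join2 one_FactGroup pow_in nat_pow_closed mult.commute)
        moreover have "(N #> a) \<otimes>\<^bsub>?Q\<^esub> (N #> b) = (N #> b) \<otimes>\<^bsub>?Q\<^esub> (N #> a)"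
          using N.rcos_commute_iff k(1) l(1) ab by blast
        from Q.pow_mult_distrib[OF this coset[OF k(1)] coset[OF l(1)]]
        have "(N #> (a \<otimes> b)) [^]\<^bsub>?Q\<^esub> ?n = (N #> a) [^]\<^bsub>?Q\<^esub> ?n \<otimes>\<^bsub>?Q\<^esub> (N #> b) [^]\<^bsub>?Q\<^esub> ?n"
          using N.rcos_sum[OF k(1) l(1)] by simp
        ultimately have "(N #> (a \<otimes> b)) [^]\<^bsub>?Q\<^esub> ?n = \<one>\<^bsub>?Q\<^esub>"
          using pow_in k(1) l(1) Q.r_one[OF Q.one_closed] by simp
        then have "(a \<otimes> b) [^] (p ^ (k + l)) \<in> N"
          using pow_in k(1) l(1) by (simp add: power_add)
        then show "a \<otimes> b \<in> ?K" using k(1) l(1) by blast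
      qed auto
      fix g a assume g: "g \<in> carrier G" and "a \<in> ?K"
      then obtain k where k: "a \<in> carrier G" "a [^] (p ^ k) \<in> N" by blast
      then have "(g \<otimes> a \<otimes> inv g) [^] (p ^ k) \<in> N"
        using g N.inv_op_closed2 by (simp add: conj_pow)
      then show "g \<otimes> a \<otimes> inv g \<in> ?K" using g k by blast
    qed
    ultimately show ?thesis using xK by blast
  qed
qed

lemma normal_p_subgroup_in_proper_normal:
  assumes p: "prime p" and K: "K \<lhd> G" "K \<noteq> carrier G"
  shows "p_elements p G \<inter> K \<lhd> G"
proof (rule normal_invI)
  interpret K: normal K G by (fact K)
  interpret KG: group "G\<lparr>carrier := K\<rparr>" using K.subgroup_axioms by (rule subgroup_imp_group)
  have "finite K" using finite_carrier K.subset by (rule finite_subset[rotated])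
  then have "p_elements p (G\<lparr>carrier := K\<rparr>) \<lhd> G\<lparr>carrier := K\<rparr>"
    using KG.primary_commuting_p_elements_normal[OF _ proper_subgroup_commuting[OF K.subgroup_axioms K(2)] p]
    by simp
  then have "subgroup (p_elements p G \<inter> K) (G\<lparr>carrier := K\<rparr>)"
    by (simp add: p_elements_subgroup K.subset normal_imp_subgroup)
  then show "subgroup (p_elements p G \<inter> K) G"
    using K.subgroup_axioms incl_subgroup by blast
  fix g x assume "g \<in> carrier G" "x \<in> p_elements p G \<inter> K"
  then show "g \<otimes> x \<otimes> inv g \<in> p_elements p G \<inter> K"
    using p_elements_conj K.inv_op_closed2 by blast
qed

end

section \<open>Coprime action in a minimal non-nilpotent group\<close>

locale schmidt_group = minimal_non_nilpotent +
  fixes p q :: nat and P v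
  assumes primes: "prime p" "prime q" "p \<noteq> q"
    and P: "P \<lhd> G" "P \<subseteq> p_elements p G"
    and v: "v \<in> p_elements q G"
    and not_centralized: "\<exists>u \<in> P. v \<otimes> u \<noteq> u \<otimes> v"

text \<open>Of two elements that violate the commuting condition, one lies in a proper normal subgroup
  \<open>K\<close>. Since \<open>K\<close> is nilpotent, its elements of \<open>p\<close>-power order form a subgroup, which is
  normal in the whole group.\<close>

lemma (in minimal_non_nilpotent) schmidt_structure:
  "\<exists>p q P v. schmidt_group G p q P v"
proof -
  have *: "\<exists>P. schmidt_group G p q P y"
    if pq: "prime p" "prime q" "p \<noteq> q" and x: "x \<in> p_elements p G" and y: "y \<in> p_elements q G"
      and nc: "x \<otimes> y \<noteq> y \<otimes> x" and K: "K \<lhd> G" "K \<noteq> carrier G" "x \<in> K" for p q x y K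
  proof -
    have "schmidt_group G p q (p_elements p G \<inter> K) y"
    proof (intro schmidt_group.intro schmidt_group_axioms.intro minimal_non_nilpotent_axioms)
      show "\<exists>u \<in> p_elements p G \<inter> K. y \<otimes> u \<noteq> u \<otimes> y"
        using x K(3) nc by (intro bexI[of _ x]) auto
    qed (use pq y normal_p_subgroup_in_proper_normal[OF pq(1) K(1,2)] in auto)
    then show ?thesis by blast
  qed
  obtain p q x y where pq: "prime p" "prime q" "p \<noteq> q" and x: "x \<in> p_elements p G"
      and y: "y \<in> p_elements q G" and nc: "x \<otimes> y \<noteq> y \<otimes> x"
    using not_commuting unfolding primary_commuting_def by blast
  obtain K where K: "K \<lhd> G" "K \<noteq> carrier G" "x \<in> K \<or> y \<in> K"
    using proper_normal_subgroup_containing[OF pq x y] by blast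
  from K(3) show ?thesis
  proof
    assume "x \<in> K"
    then show ?thesis using *[OF pq x y nc K(1,2)] by blast
  next
    assume "y \<in> K"
    then show ?thesis using *[OF pq(2,1) _ y x _ K(1,2)] pq(3) nc by metis
  qed
qed

lemma (in group) class_two_power_shift:
  assumes G: "a \<in> carrier G" "b \<in> carrier G" "w \<in> carrier G" and ba: "b \<otimes> a = a \<otimes> b \<otimes> w"
    and w: "w \<otimes> b = b \<otimes> w"
  shows "b [^] (n::nat) \<otimes> a = a \<otimes> b [^] n \<otimes> w [^] n"
proof (induction n)
  case (Suc n)
  have "b [^] Suc n \<otimes> a = b [^] n \<otimes> (b \<otimes> a)"
    using G by (simp add: m_assoc)
  also have "\<dots> = (b [^] n \<otimes> a) \<otimes> b \<otimes> w"
    unfolding ba using G by (simp add: m_assoc)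
  also have "\<dots> = a \<otimes> b [^] n \<otimes> (w [^] n \<otimes> b) \<otimes> w"
    unfolding Suc using G by (simp add: m_assoc)
  also have "\<dots> = a \<otimes> b [^] Suc n \<otimes> w [^] Suc n"
    unfolding commute_pow[OF G(3,2) w] using G by (simp add: m_assoc)
  finally show ?case .
qed (use G in simp)

text \<open>Collecting the factors \<open>a\<close> to the left moves them past the factors \<open>b\<close>, once for each of
  the \<open>n choose 2\<close> pairs, and each move costs a factor \<open>w\<close>.\<close>

lemma (in group) class_two_power:
  assumes G: "a \<in> carrier G" "b \<in> carrier G" "w \<in> carrier G" and ba: "b \<otimes> a = a \<otimes> b \<otimes> w"
    and w: "w \<otimes> a = a \<otimes> w" "w \<otimes> b = b \<otimes> w"
  shows "(a \<otimes> b) [^] (n::nat) = a [^] n \<otimes> b [^] n \<otimes> w [^] (n choose 2)"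
proof (induction n)
  case (Suc n)
  let ?k = "n choose 2"
  have c: "w [^] ?k \<otimes> a = a \<otimes> w [^] ?k" "w [^] ?k \<otimes> b = b \<otimes> w [^] ?k" "w [^] n \<otimes> b = b \<otimes> w [^] n"
    using commute_pow G w by auto
  have "(a \<otimes> b) [^] Suc n = a [^] n \<otimes> b [^] n \<otimes> (w [^] ?k \<otimes> a) \<otimes> b"
    using Suc G by (simp add: m_assoc)
  also have "\<dots> = a [^] n \<otimes> (b [^] n \<otimes> a) \<otimes> (w [^] ?k \<otimes> b)"
    unfolding c(1) using G by (simp add: m_assoc)
  also have "\<dots> = a [^] n \<otimes> (a \<otimes> b [^] n \<otimes> w [^] n) \<otimes> (b \<otimes> w [^] ?k)"
    unfolding c(2) class_two_power_shift[OF G ba w(2)] ..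
  also have "\<dots> = a [^] n \<otimes> a \<otimes> b [^] n \<otimes> (w [^] n \<otimes> b) \<otimes> w [^] ?k"
    using G by (simp add: m_assoc)
  also have "\<dots> = a [^] Suc n \<otimes> b [^] Suc n \<otimes> (w [^] n \<otimes> w [^] ?k)"
    unfolding c(3) using G by (simp add: m_assoc)
  also have "w [^] n \<otimes> w [^] ?k = w [^] (Suc n choose 2)"
    using G by (simp add: nat_pow_mult numeral_2_eq_2)
  finally show ?case .
qed (use G in \<open>simp add: numeral_2_eq_2\<close>)

context schmidt_group
begin

sublocale P: normal P G by (fact P)

lemma vG: "v \<in> carrier G" using v by (rule p_elements_closed)

definition C :: "'a set" where "C = {a \<in> P. v \<otimes> a = a \<otimes> v}"

lemma C_subset: "C \<subseteq> P" unfolding C_def by blast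

lemma P_conj_v: "a \<in> P \<Longrightarrow> v \<otimes> a \<otimes> inv v \<in> P"
  using P.inv_op_closed2 vG by blast

lemma C_iff: "a \<in> C \<longleftrightarrow> a \<in> P \<and> v \<otimes> a \<otimes> inv v = a"
  using vG unfolding C_def by (auto simp: inv_solve_right' inv_solve_right)

lemma C_proper: "C \<noteq> P"
  using not_centralized unfolding C_def by blast

lemma P_q_element_trivial: "\<lbrakk>a \<in> P; a \<in> p_elements q G\<rbrakk> \<Longrightarrow> a = \<one>"
  using p_elements_disjoint[OF primes] P(2) by blast

text \<open>If \<open>v\<close> fixes \<open>a\<close> modulo \<open>C\<close>, then it fixes \<open>a\<close>: the order of the commutator
  divides a power of \<open>q\<close>, and the commutator is a \<open>p\<close>-element.\<close>

lemma fixed_if_commutator_fixed: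
  assumes a: "a \<in> P" and c: "v \<otimes> a \<otimes> inv v \<otimes> inv a \<in> C"
  shows "a \<in> C"
proof -
  let ?c = "v \<otimes> a \<otimes> inv v \<otimes> inv a"
  have G: "a \<in> carrier G" "?c \<in> carrier G"
    using a vG by simp_all
  obtain l where l: "v [^] (q ^ l) = \<one>"
    using v unfolding p_elements_def by blast
  have shift: "v \<otimes> a \<otimes> inv v = ?c \<otimes> a"
    using a vG by (simp add: word_simps)
  have commutes: "v \<otimes> ?c = ?c \<otimes> v"
    using c unfolding C_def by blast
  from conj_pow_shift[OF vG G shift commutes, of "q ^ l"] have "?c [^] (q ^ l) = \<one>"
    using l G by simp
  then have "?c \<in> p_elements q G"
    using G unfolding p_elements_def by blast
  then have "?c = \<one>"
    using c C_subset P_q_element_trivial by blast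
  then have "v \<otimes> a \<otimes> inv v = a"
    using G vG by (metis inv_equality inv_closed inv_inv m_closed)
  then show ?thesis
    using a C_iff by blast
qed

text \<open>The subgroup generated by \<open>S\<close> and \<open>v\<close> is proper, hence nilpotent: if it contained an
  element \<open>a\<close> of \<open>P\<close> outside \<open>S\<close>, then \<open>P\<close> would contain a nontrivial power of \<open>v\<close>.\<close>

lemma invariant_subgroup_fixed:
  assumes S: "subgroup S G" "S \<subseteq> P" "S \<noteq> P" and inv: "\<And>s. s \<in> S \<Longrightarrow> v \<otimes> s \<otimes> inv v \<in> S"
  shows "S \<subseteq> C"
proof -
  interpret S: subgroup S G by (fact S)
  let ?H = "generate G {v}"
  have H: "?H = {v [^] k | k. k \<in> (UNIV :: nat set)}"
    using finite_carrier vG by (rule generate_pow_on_finite_carrier)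
  have sH: "subgroup ?H G"
    using vG by (intro generate_is_subgroup) simp
  have norm: "v [^] (n::nat) \<otimes> s \<otimes> inv (v [^] n) \<in> S" if "s \<in> S" for n s
    using that
  proof (induction n arbitrary: s)
    case (Suc n)
    have "v [^] Suc n \<otimes> s \<otimes> inv (v [^] Suc n) = v [^] n \<otimes> (v \<otimes> s \<otimes> inv v) \<otimes> inv (v [^] n)"
      using Suc.prems vG by (simp add: word_simps)
    then show ?case using Suc inv by simp
  qed simp
  have sK: "subgroup (S <#> ?H) G"
  proof (rule set_mult_normalized_subgroup[OF S(1) sH])
    fix h s assume "h \<in> ?H" "s \<in> S"
    then show "h \<otimes> s \<otimes> inv h \<in> S" unfolding H using norm by blast
  qed
  have K_proper: "S <#> ?H \<noteq> carrier G"
  proof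
    assume K: "S <#> ?H = carrier G"
    obtain a where a: "a \<in> P" "a \<notin> S" using S by blast
    then have "a \<in> S <#> ?H" using K by simp
    then obtain s n where s: "s \<in> S" "a = s \<otimes> v [^] (n::nat)"
      unfolding set_mult_def H by blast
    then have "v [^] n = inv s \<otimes> a"
      using vG by simp
    moreover have "inv s \<otimes> a \<in> P"
      using s(1) a(1) S(2) by blast
    ultimately have "v [^] n = \<one>"
      using p_elements_pow[OF v, of n] P_q_element_trivial by simp
    then show False using s a(2) by simp
  qed
  have "v \<in> S <#> ?H"
    using set_mult_factors_subset(2)[OF S(1) sH] generate.incl[of v "{v}" G] by blast
  moreover have "S \<subseteq> S <#> ?H"
    using set_mult_factors_subset(1)[OF S(1) sH] .
  moreover have "\<forall>p q. \<forall>x \<in> p_elements p G \<inter> (S <#> ?H). \<forall>y \<in> p_elements q G \<inter> (S <#> ?H).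
      prime p \<longrightarrow> prime q \<longrightarrow> p \<noteq> q \<longrightarrow> x \<otimes> y = y \<otimes> x"
    using proper_subgroup_commuting[OF sK K_proper] unfolding primary_commuting_subgroup[OF sK] .
  ultimately have "s \<otimes> v = v \<otimes> s" if "s \<in> S" for s
    using that S(2) P(2) v primes by blast
  then show ?thesis
    unfolding C_def using S(2) by auto
qed

lemma C_subgroup: "subgroup C G"
proof (rule subgroupI)
  show "C \<subseteq> carrier G" using C_subset P.subset by blast
  have "\<one> \<in> C" unfolding C_def using vG by simp
  then show "C \<noteq> {}" by blast
  fix a assume a: "a \<in> C"
  then have aG: "a \<in> P" "a \<in> carrier G" "v \<otimes> a \<otimes> inv v = a"
    using C_subset unfolding C_iff by auto
  have "v \<otimes> inv a \<otimes> inv v = inv (v \<otimes> a \<otimes> inv v)"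
    using aG(2) vG by (simp add: word_simps)
  then show "inv a \<in> C"
    using aG unfolding C_iff by simp
  fix b assume "b \<in> C"
  then have bG: "b \<in> P" "b \<in> carrier G" "v \<otimes> b \<otimes> inv v = b"
    using C_subset unfolding C_iff by auto
  have "v \<otimes> (a \<otimes> b) \<otimes> inv v = (v \<otimes> a \<otimes> inv v) \<otimes> (v \<otimes> b \<otimes> inv v)"
    using aG(2) bG(2) vG by (simp add: word_simps)
  then show "a \<otimes> b \<in> C"
    using aG bG unfolding C_iff by simp
qed

sublocale C: subgroup C G by (rule C_subgroup)

lemma P_proper: "P \<noteq> carrier G"
proof
  assume "P = carrier G"
  then have "v = \<one>"
    using v vG P_q_element_trivial by blast
  then show False
    using not_centralized by auto
qed

lemma relative_center_element: "\<exists>z \<in> P - C. \<forall>m \<in> P. commutator z m \<in> C"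
  using proper_relative_center[OF P.subgroup_axioms P_proper C.one_closed] C_subset C_proper by blast

text \<open>The normalizer of \<open>C\<close> in \<open>P\<close> is \<open>v\<close>-invariant and, as \<open>P\<close> is nilpotent, properly
  larger than \<open>C\<close>.\<close>

lemma C_normalized:
  assumes "a \<in> P" "c \<in> C"
  shows "a \<otimes> c \<otimes> inv a \<in> C"
proof -
  have CG: "C \<subseteq> carrier G" by (rule C.subset)
  let ?K = "P \<inter> normalizer G C"
  have sN: "subgroup (normalizer G C) G"
    using CG by (rule normalizer_imp_subgroup)
  then have sK: "subgroup ?K G"
    using P.subgroup_axioms by (intro subgroups_Inter_pair)
  have vN: "v \<in> normalizer G C"
    using C_iff by (intro normalizerI[OF finite_carrier CG vG]) simp
  have inv: "v \<otimes> s \<otimes> inv v \<in> ?K" if "s \<in> ?K" for s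
    using that P_conj_v vN sN by (auto intro: subgroup.m_closed subgroup.m_inv_closed)
  obtain z where z: "z \<in> P" "z \<notin> C" "\<And>m. m \<in> P \<Longrightarrow> commutator z m \<in> C"
    using relative_center_element by blast
  have "z \<in> normalizer G C"
  proof (rule normalizerI[OF finite_carrier CG P.mem_carrier[OF z(1)]])
    fix x assume x: "x \<in> C"
    have "z \<otimes> x \<otimes> inv z = commutator z x \<otimes> x"
      using P.mem_carrier[OF z(1)] C.mem_carrier[OF x] by (simp add: commutator_def word_simps)
    moreover have "commutator z x \<otimes> x \<in> C"
      using x z(3) C_subset by blast
    ultimately show "z \<otimes> x \<otimes> inv z \<in> C" by simp
  qed
  then have "\<not> ?K \<subseteq> C" using z by blast
  then have "?K = P"
    using invariant_subgroup_fixed[OF sK _ _ inv] by blast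
  then have "a \<in> normalizer G C" using assms(1) by blast
  then show ?thesis
    using assms(2) normalizer_iff[OF CG] unfolding conj_set_eq by blast
qed

text \<open>A form of the three subgroups lemma: for \<open>a \<in> P\<close> both \<open>c\<close> and its conjugate by
  \<open>a\<close> are fixed by \<open>v\<close>, so \<open>a\<close> and its image under \<open>v\<close> conjugate \<open>c\<close> in the same way, and
  their quotient centralizes \<open>c\<close>. If the centralizer of \<open>C\<close> in \<open>P\<close> were proper, it would be
  contained in \<open>C\<close>, and \<open>v\<close> would fix every element of \<open>P\<close> modulo \<open>C\<close>, hence every
  element of \<open>P\<close>.\<close>

lemma C_central:
  assumes "a \<in> P" "c \<in> C"
  shows "a \<otimes> c = c \<otimes> a"
proof -
  let ?Z = "{a \<in> P. \<forall>c \<in> C. a \<otimes> c = c \<otimes> a}"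
  have sZ: "subgroup ?Z G"
  proof (rule subgroupI)
    show "?Z \<subseteq> carrier G" using P.subset by blast
    have "\<one> \<in> ?Z" by simp
    then show "?Z \<noteq> {}" by blast
    fix a assume a: "a \<in> ?Z"
    then have aG: "a \<in> P" "a \<in> carrier G" by auto
    have "inv a \<otimes> c = c \<otimes> inv a" if "c \<in> C" for c
    proof -
      have "inv a \<otimes> c = inv a \<otimes> (c \<otimes> a) \<otimes> inv a"
        using aG C.mem_carrier[OF that] by (simp add: m_assoc)
      also have "c \<otimes> a = a \<otimes> c" using a that by simp
      also have "inv a \<otimes> (a \<otimes> c) \<otimes> inv a = c \<otimes> inv a"
        using aG C.mem_carrier[OF that] by simp
      finally show ?thesis .
    qed
    then show "inv a \<in> ?Z" using aG by simp
    fix b assume b: "b \<in> ?Z"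
    then have bG: "b \<in> P" "b \<in> carrier G" by auto
    have "a \<otimes> b \<otimes> c = c \<otimes> (a \<otimes> b)" if "c \<in> C" for c
    proof -
      have cG: "c \<in> carrier G" using that by simp
      have "a \<otimes> b \<otimes> c = a \<otimes> (c \<otimes> b)"
        using b that aG bG cG by (simp add: m_assoc)
      also have "\<dots> = (c \<otimes> a) \<otimes> b"
        using a that aG bG cG by (simp add: m_assoc[symmetric])
      finally show ?thesis using aG bG cG by (simp add: m_assoc)
    qed
    then show "a \<otimes> b \<in> ?Z" using aG bG by simp
  qed
  have inv: "v \<otimes> s \<otimes> inv v \<in> ?Z" if s: "s \<in> ?Z" for s
  proof -
    have sG: "s \<in> P" "s \<in> carrier G" using s by auto
    have "(v \<otimes> s \<otimes> inv v) \<otimes> c = c \<otimes> (v \<otimes> s \<otimes> inv v)" if c: "c \<in> C" for c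
    proof -
      have cG: "c \<in> carrier G" and vc: "v \<otimes> c \<otimes> inv v = c"
        using c C_iff by auto
      have "(v \<otimes> s \<otimes> inv v) \<otimes> (v \<otimes> c \<otimes> inv v) = v \<otimes> (s \<otimes> c) \<otimes> inv v"
        using sG cG vG by (simp add: word_simps)
      also have "s \<otimes> c = c \<otimes> s" using s c by simp
      also have "v \<otimes> (c \<otimes> s) \<otimes> inv v = (v \<otimes> c \<otimes> inv v) \<otimes> (v \<otimes> s \<otimes> inv v)"
        using sG cG vG by (simp add: word_simps)
      finally show ?thesis unfolding vc .
    qed
    then show ?thesis using P_conj_v sG by simp
  qed
  have com: "v \<otimes> a \<otimes> inv v \<otimes> inv a \<in> ?Z" if a: "a \<in> P" for a
  proof -
    have aG: "a \<in> carrier G" using a by simp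
    let ?y = "v \<otimes> a \<otimes> inv v \<otimes> inv a"
    have yP: "?y \<in> P" using a P_conj_v by simp
    have "?y \<otimes> c = c \<otimes> ?y" if c: "c \<in> C" for c
    proof -
      have cG: "c \<in> carrier G" using c by simp
      have "inv a \<otimes> c \<otimes> inv (inv a) \<in> C"
        using C_normalized a c by blast
      then have "v \<otimes> (inv a \<otimes> c \<otimes> a) \<otimes> inv v = inv a \<otimes> c \<otimes> a"
        using aG unfolding C_iff by simp
      moreover have "v \<otimes> (inv a \<otimes> c \<otimes> a) \<otimes> inv v
          = (v \<otimes> inv a \<otimes> inv v) \<otimes> (v \<otimes> c \<otimes> inv v) \<otimes> (v \<otimes> a \<otimes> inv v)"
        using aG cG vG by (simp add: word_simps)
      moreover have "v \<otimes> c \<otimes> inv v = c" using c C_iff by blast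
      ultimately have *: "(v \<otimes> inv a \<otimes> inv v) \<otimes> c \<otimes> (v \<otimes> a \<otimes> inv v) = inv a \<otimes> c \<otimes> a"
        by simp
      have "c \<otimes> ?y = (v \<otimes> a \<otimes> inv v) \<otimes> ((v \<otimes> inv a \<otimes> inv v) \<otimes> c \<otimes> (v \<otimes> a \<otimes> inv v)) \<otimes> inv a"
        using aG cG vG by (simp add: word_simps)
      also have "\<dots> = ?y \<otimes> c"
        unfolding * using aG cG vG by (simp add: word_simps)
      finally show ?thesis by simp
    qed
    then show ?thesis using yP by simp
  qed
  have "?Z = P"
  proof (rule ccontr)
    assume "?Z \<noteq> P"
    then have "?Z \<subseteq> C"
      using invariant_subgroup_fixed[OF sZ _ _ inv] by blast
    then have "P \<subseteq> C"
      using com fixed_if_commutator_fixed by blast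
    then show False using C_subset C_proper by blast
  qed
  then show ?thesis using assms by blast
qed

text \<open>The preimage in \<open>P\<close> of the center of \<open>P / C\<close> is \<open>v\<close>-invariant and larger than
  \<open>C\<close>.\<close>

lemma commutators_in_C:
  assumes "a \<in> P" "b \<in> P"
  shows "commutator a b \<in> C"
proof -
  let ?GP = "G\<lparr>carrier := P\<rparr>"
  interpret GP: group ?GP using P.subgroup_axioms by (rule subgroup_imp_group)
  have "C \<lhd> ?GP"
  proof (rule GP.normal_invI)
    show "subgroup C ?GP"
      using C_subgroup P.subgroup_axioms C_subset by (rule subgroup_incl)
    fix x h assume "x \<in> carrier ?GP" "h \<in> C"
    then show "x \<otimes>\<^bsub>?GP\<^esub> h \<otimes>\<^bsub>?GP\<^esub> inv\<^bsub>?GP\<^esub> x \<in> C"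
      using C_normalized by (simp add: P.subgroup_axioms)
  qed
  then have "{z \<in> carrier ?GP. \<forall>g \<in> carrier ?GP. GP.commutator z g \<in> C} \<lhd> ?GP"
    by (rule GP.relative_center_normal)
  moreover let ?K = "{z \<in> P. \<forall>g \<in> P. commutator z g \<in> C}"
  have "{z \<in> carrier ?GP. \<forall>g \<in> carrier ?GP. GP.commutator z g \<in> C} = ?K"
    using commutator_subgroup[OF P.subgroup_axioms] by auto
  ultimately have "?K \<lhd> ?GP" by (simp only:)
  from incl_subgroup[OF P.subgroup_axioms normal_imp_subgroup[OF this]]
  have sK: "subgroup ?K G" .
  have inv: "v \<otimes> s \<otimes> inv v \<in> ?K" if s: "s \<in> ?K" for s
  proof -
    have sG: "s \<in> P" "s \<in> carrier G" using s by auto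
    have "commutator (v \<otimes> s \<otimes> inv v) g \<in> C" if g: "g \<in> P" for g
    proof -
      have "inv v \<otimes> g \<otimes> v \<in> P"
        using P.inv_op_closed1[OF vG g] .
      then have "commutator s (inv v \<otimes> g \<otimes> v) \<in> C" using s by blast
      then have "v \<otimes> commutator s (inv v \<otimes> g \<otimes> v) \<otimes> inv v \<in> C"
        using C_iff by simp
      moreover have "v \<otimes> commutator s (inv v \<otimes> g \<otimes> v) \<otimes> inv v = commutator (v \<otimes> s \<otimes> inv v) g"
        using sG vG P.mem_carrier[OF g] by (simp add: commutator_def word_simps)
      ultimately show ?thesis by simp
    qed
    then show ?thesis using P_conj_v sG by simp
  qed
  have "\<not> ?K \<subseteq> C" using relative_center_element by blast
  then have "?K = P"
    using invariant_subgroup_fixed[OF sK _ _ inv] by blast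
  then show ?thesis using assms by blast
qed

lemma product_power:
  assumes "a \<in> P" "b \<in> P"
  shows "(a \<otimes> b) [^] (n::nat) = a [^] n \<otimes> b [^] n \<otimes> commutator (inv b) (inv a) [^] (n choose 2)"
proof (rule class_two_power)
  have w: "commutator (inv b) (inv a) \<in> C"
    using assms commutators_in_C by blast
  show "commutator (inv b) (inv a) \<otimes> a = a \<otimes> commutator (inv b) (inv a)"
    "commutator (inv b) (inv a) \<otimes> b = b \<otimes> commutator (inv b) (inv a)"
    using C_central[OF assms(1) w] C_central[OF assms(2) w] by simp_all
  show "b \<otimes> a = a \<otimes> b \<otimes> commutator (inv b) (inv a)"
    using assms by (simp add: commutator_def word_simps)
qed (use assms in simp_all)

lemma C_pow: "c \<in> C \<Longrightarrow> c [^] (n::nat) \<in> C"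
  by (induction n) auto

text \<open>Since \<open>P / C\<close> is abelian, the elements whose \<open>p\<close>-th power lies in \<open>C\<close> form a
  subgroup. It is not contained in \<open>C\<close>: among the iterated \<open>p\<close>-th powers of an element outside
  \<open>C\<close>, consider the last one that is not in \<open>C\<close>.\<close>

lemma pth_power_in_C:
  assumes "a \<in> P"
  shows "a [^] p \<in> C"
proof -
  let ?L = "{a \<in> P. a [^] p \<in> C}"
  have sL: "subgroup ?L G"
  proof (rule subgroupI)
    show "?L \<subseteq> carrier G" using P.subset by blast
    have "\<one> \<in> ?L" by simp
    then show "?L \<noteq> {}" by blast
    fix a assume a: "a \<in> ?L"
    then show "inv a \<in> ?L" by (simp add: nat_pow_inv)
    fix b assume b: "b \<in> ?L"
    have "commutator (inv b) (inv a) [^] (p choose 2) \<in> C"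
      using a b commutators_in_C C_pow by simp
    then show "a \<otimes> b \<in> ?L"
      using a b product_power[of a b p] by simp
  qed
  have inv: "v \<otimes> s \<otimes> inv v \<in> ?L" if s: "s \<in> ?L" for s
    using s P_conj_v vG C_iff by (simp add: conj_pow)
  obtain a where a: "a \<in> P" "a \<notin> C" using C_subset C_proper by blast
  then obtain k where k: "a [^] (p ^ k) = \<one>"
    using P(2) unfolding p_elements_def by blast
  define j where "j = (LEAST j. a [^] (p ^ j) \<in> C)"
  have "a [^] (p ^ k) \<in> C" using k by simp
  then have j: "a [^] (p ^ j) \<in> C"
    unfolding j_def by (rule LeastI)
  have "j \<noteq> 0"
    using j a by (intro notI) simp
  then obtain i where i: "j = Suc i" using not0_implies_Suc by blast
  have "a [^] (p ^ i) \<notin> C"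
    using not_less_Least[of i "\<lambda>j. a [^] (p ^ j) \<in> C"] i unfolding j_def by simp
  moreover have "(a [^] (p ^ i)) [^] p \<in> C"
    using j a(1) unfolding i by (simp add: nat_pow_pow mult.commute)
  moreover have "a [^] n \<in> P" for n :: nat
    using a(1) by (induction n) auto
  ultimately have "\<not> ?L \<subseteq> C" by blast
  then have "?L = P"
    using invariant_subgroup_fixed[OF sL _ _ inv] by blast
  then show ?thesis using assms by blast
qed

text \<open>The commutator is the product of \<open>b = v a v\<^sup>-\<^sup>1\<close> and \<open>a\<^sup>-\<^sup>1\<close>, and \<open>b\<^sup>p = a\<^sup>p\<close>
  because \<open>v\<close> fixes \<open>a\<^sup>p\<close>. So its \<open>p\<close>-th power is a power of a central commutator \<open>w\<close> with
  exponent \<open>p choose 2\<close>, where \<open>w\<close> has order dividing \<open>p\<close>. This exponent is a multiple of \<open>p\<close>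
  for odd \<open>p\<close> and equals 1 for \<open>p = 2\<close>.\<close>

lemma commutator_with_v_order:
  assumes a: "a \<in> P"
  shows "commutator v a [^] (if p = 2 then 4 else p) = \<one>"
proof -
  let ?b = "v \<otimes> a \<otimes> inv v"
  let ?w = "commutator a (inv ?b)"
  have b: "?b \<in> P" using a by (rule P_conj_v)
  have G: "a \<in> carrier G" "?b \<in> carrier G" using P.mem_carrier[OF a] P.mem_carrier[OF b] by blast+
  have wC: "?w \<in> C" using a b commutators_in_C by blast
  then have wG: "?w \<in> carrier G" by simp
  have ap: "a [^] p \<in> C" "inv a [^] p \<in> C"
    using a pth_power_in_C by auto
  have bp: "?b [^] p = a [^] p"
    using ap(1) G(1) vG C_iff by (simp add: conj_pow)
  have "(?b \<otimes> inv a) [^] p = ?b [^] p \<otimes> inv a [^] p \<otimes> commutator (inv (inv a)) (inv ?b) [^] (p choose 2)"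
    using product_power[OF b P.m_inv_closed[OF a]] .
  also have "\<dots> = ?w [^] (p choose 2)"
    unfolding bp using G wG by (simp add: nat_pow_inv)
  finally have yp: "commutator v a [^] p = ?w [^] (p choose 2)"
    by (simp add: commutator_def)
  have "inv a \<otimes> ?b = ?b \<otimes> inv a \<otimes> ?w"
    using a vG by (simp add: commutator_def word_simps)
  from class_two_power_shift[OF G(2) inv_closed[OF G(1)] wG this, of p]
  have "inv a [^] p \<otimes> ?b = ?b \<otimes> inv a [^] p \<otimes> ?w [^] p"
    using C_central[OF P.m_inv_closed[OF a] wC] by simp
  then have "?b \<otimes> inv a [^] p = ?b \<otimes> inv a [^] p \<otimes> ?w [^] p"
    using C_central[OF b ap(2)] by simp
  then have wp: "?w [^] p = \<one>"
    using G wG by (metis inv_closed l_cancel_one' m_closed nat_pow_closed)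
  show ?thesis
  proof (cases "p = 2")
    case True
    have "commutator v a [^] (2 * 2 :: nat) = (commutator v a [^] p) [^] p"
      using True G vG nat_pow_pow[of "commutator v a" 2 2] by simp
    also have "\<dots> = \<one>"
      unfolding yp using True wp wG by (simp add: numeral_2_eq_2)
    finally show ?thesis using True by simp
  next
    case False
    then have "p dvd p choose 2"
      using primes(1) prime_ge_2_nat[of p] by (intro dvd_choose_prime) auto
    then obtain m where "p choose 2 = p * m" by blast
    then have "?w [^] (p choose 2) = \<one>"
      using wp wG nat_pow_pow[of ?w p m] by simp
    then show ?thesis using yp False by simp
  qed
qed

end

section \<open>Elements of order 4\<close>

text \<open>What an HC-subgroup generated by \<open>y\<close> says about the conjugates of \<open>y\<close> itself, with
  membership in the cyclic subgroup and its normalizer spelled out by powers of \<open>y\<close>. In this form the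
  condition restricts to subgroups by intersecting \<open>T\<close> with them.\<close>

definition HC_element :: "'a \<Rightarrow> ('a, 'b) monoid_scheme \<Rightarrow> bool"
  where "HC_element y G \<longleftrightarrow> (\<exists>T. T \<lhd> G \<and>
    (\<forall>g \<in> carrier G. \<exists>n::nat. \<exists>t \<in> T. g = y [^]\<^bsub>G\<^esub> n \<otimes>\<^bsub>G\<^esub> t) \<and>
    (\<forall>g \<in> carrier G. \<forall>z. z = inv\<^bsub>G\<^esub> g \<otimes>\<^bsub>G\<^esub> y \<otimes>\<^bsub>G\<^esub> g \<longrightarrow> z \<in> T \<longrightarrow>
      (\<exists>m::nat. z \<otimes>\<^bsub>G\<^esub> y \<otimes>\<^bsub>G\<^esub> inv\<^bsub>G\<^esub> z = y [^]\<^bsub>G\<^esub> m) \<longrightarrow>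
      (\<exists>n::nat. z = y [^]\<^bsub>G\<^esub> n)))"

lemma (in group) HC_subgroup_imp_HC_element:
  assumes HC: "HC_subgroup (generate G {y}) G" and fin: "finite (carrier G)" and y: "y \<in> carrier G"
  shows "HC_element y G"
proof -
  let ?H = "generate G {y}"
  have H: "?H = {y [^] k | k. k \<in> (UNIV :: nat set)}"
    using fin y by (rule generate_pow_on_finite_carrier)
  have HG: "?H \<subseteq> carrier G" using y generate_incl by simp
  have yH: "y \<in> ?H" by (rule generate.incl) simp
  obtain T where T: "T \<lhd> G" "carrier G = ?H <#> T"
      and conj: "\<And>g. g \<in> carrier G \<Longrightarrow> (inv g <# ?H #> g) \<inter> (T \<inter> normalizer G ?H) \<subseteq> ?H"
    using HC unfolding HC_subgroup_def by blast
  have "\<exists>n::nat. \<exists>t \<in> T. g = y [^] n \<otimes> t" if "g \<in> carrier G" for g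
    using that T(2) unfolding set_mult_def H by blast
  moreover have "\<exists>n::nat. z = y [^] n"
    if g: "g \<in> carrier G" and z: "z = inv g \<otimes> y \<otimes> g" "z \<in> T" and m: "z \<otimes> y \<otimes> inv z = y [^] (m::nat)"
    for g z m
  proof -
    have zG: "z \<in> carrier G" using g y z(1) by simp
    have "z \<in> normalizer G ?H"
    proof (rule normalizerI[OF fin HG zG])
      fix x assume "x \<in> ?H"
      then obtain k where "x = y [^] (k::nat)" unfolding H by blast
      then have "z \<otimes> x \<otimes> inv z = y [^] (m * k)"
        using conj_pow[OF zG y, of k] m y by (simp add: nat_pow_pow)
      then show "z \<otimes> x \<otimes> inv z \<in> ?H" unfolding H by blast
    qed
    moreover have "z \<in> inv g <# ?H #> g"
      using yH z(1) unfolding l_coset_def r_coset_def by blast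
    ultimately have "z \<in> ?H" using conj[OF g] z(2) by blast
    then show ?thesis unfolding H by blast
  qed
  ultimately show ?thesis
    unfolding HC_element_def using T(1) by blast
qed

lemma (in group) HC_elementE:
  assumes "HC_element y G"
  obtains T where "T \<lhd> G"
    and "\<And>g. g \<in> carrier G \<Longrightarrow> \<exists>n::nat. \<exists>t \<in> T. g = y [^] n \<otimes> t"
    and "\<And>g m. \<lbrakk>g \<in> carrier G; inv g \<otimes> y \<otimes> g \<in> T;
      (inv g \<otimes> y \<otimes> g) \<otimes> y \<otimes> inv (inv g \<otimes> y \<otimes> g) = y [^] (m::nat)\<rbrakk>
      \<Longrightarrow> \<exists>n::nat. inv g \<otimes> y \<otimes> g = y [^] n"
proof -
  obtain T where "T \<lhd> G" "\<forall>g \<in> carrier G. \<exists>n::nat. \<exists>t \<in> T. g = y [^] n \<otimes> t"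
    and conj: "\<forall>g \<in> carrier G. \<forall>z. z = inv g \<otimes> y \<otimes> g \<longrightarrow> z \<in> T \<longrightarrow>
      (\<exists>m::nat. z \<otimes> y \<otimes> inv z = y [^] m) \<longrightarrow> (\<exists>n::nat. z = y [^] n)"
    using assms unfolding HC_element_def by (elim exE conjE)
  show ?thesis
  proof (rule that)
    show "\<exists>n::nat. inv g \<otimes> y \<otimes> g = y [^] n"
      if "g \<in> carrier G" "inv g \<otimes> y \<otimes> g \<in> T"
        "(inv g \<otimes> y \<otimes> g) \<otimes> y \<otimes> inv (inv g \<otimes> y \<otimes> g) = y [^] (m::nat)" for g m
      using bspec[OF conj that(1), THEN spec, THEN mp, OF refl] that(2,3) by blast
  qed (use \<open>T \<lhd> G\<close> \<open>\<forall>g \<in> carrier G. \<exists>n::nat. \<exists>t \<in> T. g = y [^] n \<otimes> t\<close> in blast)+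
qed

lemma (in group) HC_element_subgroup:
  assumes HC: "HC_element y G" and M: "subgroup M G" and y: "y \<in> M"
  shows "HC_element y (G\<lparr>carrier := M\<rparr>)"
proof -
  let ?GM = "G\<lparr>carrier := M\<rparr>"
  interpret M: subgroup M G by (fact M)
  interpret GM: group ?GM using M by (rule subgroup_imp_group)
  obtain T where T: "T \<lhd> G"
      and prod: "\<And>g. g \<in> carrier G \<Longrightarrow> \<exists>n::nat. \<exists>t \<in> T. g = y [^] n \<otimes> t"
      and conj: "\<And>g m. \<lbrakk>g \<in> carrier G; inv g \<otimes> y \<otimes> g \<in> T;
        (inv g \<otimes> y \<otimes> g) \<otimes> y \<otimes> inv (inv g \<otimes> y \<otimes> g) = y [^] (m::nat)\<rbrakk>
        \<Longrightarrow> \<exists>n::nat. inv g \<otimes> y \<otimes> g = y [^] n"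
    by (rule HC_elementE[OF HC]) (rule that)
  interpret T: normal T G by (fact T)
  have pow: "x [^]\<^bsub>?GM\<^esub> n = x [^] n" for x and n :: nat
    by (simp add: nat_pow_def)
  have yG: "y \<in> carrier G" using y by simp
  have ypow: "y [^] n \<in> M" for n :: nat
    using y by (induction n) auto
  have inv: "inv\<^bsub>?GM\<^esub> x = inv x" if "x \<in> M" for x
    using M that by (rule m_inv_consistent)
  have "T \<inter> M \<lhd> ?GM"
  proof (rule GM.normal_invI)
    show "subgroup (T \<inter> M) ?GM"
      using subgroups_Inter_pair[OF T.subgroup_axioms M] M by (rule subgroup_incl) simp
    fix x h assume "x \<in> carrier ?GM" "h \<in> T \<inter> M"
    then show "x \<otimes>\<^bsub>?GM\<^esub> h \<otimes>\<^bsub>?GM\<^esub> inv\<^bsub>?GM\<^esub> x \<in> T \<inter> M"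
      using T.inv_op_closed2 inv by simp
  qed
  moreover have "\<exists>n::nat. \<exists>t \<in> T \<inter> M. g = y [^] n \<otimes> t" if g: "g \<in> M" for g
  proof -
    obtain n t where nt: "t \<in> T" "g = y [^] (n::nat) \<otimes> t"
      using prod[of g] g by auto
    then have "t = inv (y [^] n) \<otimes> g"
      using yG by simp
    then have "t \<in> M"
      using g ypow by simp
    then show ?thesis using nt by blast
  qed
  moreover have "\<exists>n::nat. z = y [^] n"
    if g: "g \<in> M" and z: "z = inv\<^bsub>?GM\<^esub> g \<otimes> y \<otimes> g" "z \<in> T \<inter> M"
      and m: "z \<otimes> y \<otimes> inv\<^bsub>?GM\<^esub> z = y [^] (m::nat)" for g z m
    using conj[of g m] g z m inv by auto
  ultimately show ?thesis
    unfolding HC_element_def pow by (intro exI[of _ "T \<inter> M"]) auto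
qed

lemma (in schmidt_group) commutator_with_v_outside_C:
  "\<exists>a \<in> P. commutator v a \<notin> C"
proof (rule ccontr)
  assume "\<not> (\<exists>a \<in> P. commutator v a \<notin> C)"
  then have "P \<subseteq> C"
    using fixed_if_commutator_fixed unfolding commutator_def by blast
  then show False using C_subset C_proper by blast
qed

text \<open>Both cases for \<open>T\<close> lead to \<open>v\<^sup>-\<^sup>1 y v \<in> \<langle>y\<rangle> C\<close>.

  If \<open>T\<close> contains \<open>P\<close>, the condition applies to every conjugate of \<open>y\<close> that normalizes
  \<open>\<langle>y\<rangle>\<close>. Conjugates by elements of \<open>P\<close> do, because they differ from \<open>y\<close> by a central
  element; so they are powers of \<open>y\<close>, which means that \<open>P\<close> normalizes \<open>\<langle>y\<rangle>\<close>. Hence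
  \<open>v\<^sup>-\<^sup>1 y v\<close>, an element of \<open>P\<close>, normalizes \<open>\<langle>y\<rangle>\<close> and is itself a power of \<open>y\<close>.
  If \<open>T\<close> does not contain \<open>P\<close>, then \<open>P \<inter> T\<close> is a proper \<open>v\<close>-invariant subgroup and so is
  contained in \<open>C\<close>, while \<open>G = \<langle>y\<rangle> T\<close>.

  As \<open>y\<^sup>2 \<in> C\<close>, only the parity of the exponent matters: an even one puts \<open>y\<close> into
  \<open>C\<close>, and an odd one says that \<open>v\<close> fixes \<open>y\<close> modulo \<open>C\<close>.\<close>

lemma (in schmidt_group) not_HC_element:
  assumes p: "p = 2" and y: "y \<in> P" "y \<notin> C"
  shows "\<not> HC_element y G"
proof
  assume HC: "HC_element y G"
  obtain T where T: "T \<lhd> G"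
      and prod: "\<And>g. g \<in> carrier G \<Longrightarrow> \<exists>n::nat. \<exists>t \<in> T. g = y [^] n \<otimes> t"
      and conj: "\<And>g m. \<lbrakk>g \<in> carrier G; inv g \<otimes> y \<otimes> g \<in> T;
        (inv g \<otimes> y \<otimes> g) \<otimes> y \<otimes> inv (inv g \<otimes> y \<otimes> g) = y [^] (m::nat)\<rbrakk>
        \<Longrightarrow> \<exists>n::nat. inv g \<otimes> y \<otimes> g = y [^] n"
    by (rule HC_elementE[OF HC]) (rule that)
  interpret T: normal T G by (fact T)
  have yG: "y \<in> carrier G" using y by simp
  have ypow: "y [^] n \<in> P" for n :: nat
    using y by (induction n) auto
  let ?z = "inv v \<otimes> y \<otimes> v"
  have zP: "?z \<in> P" using P.inv_op_closed1[OF vG y(1)] .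
  then have zG: "?z \<in> carrier G" by simp
  have "\<exists>k::nat. \<exists>c \<in> C. ?z = y [^] k \<otimes> c"
  proof (cases "P \<subseteq> T")
    case True
    have "\<exists>n::nat. inv g \<otimes> y \<otimes> g = y [^] n" if g: "g \<in> P" for g
    proof -
      have gG: "g \<in> carrier G" using g by simp
      let ?c = "commutator (inv y) (inv g)"
      have c: "?c \<in> C" using y(1) g commutators_in_C by simp
      have zc: "inv g \<otimes> y \<otimes> g = y \<otimes> ?c"
        using yG gG by (simp add: commutator_def word_simps)
      have "(y \<otimes> ?c) \<otimes> y = y \<otimes> (?c \<otimes> y)"
        using yG gG by (simp add: m_assoc)
      also have "?c \<otimes> y = y \<otimes> ?c"
        using C_central[OF y(1) c] by simp
      finally have "(y \<otimes> ?c) \<otimes> y \<otimes> inv (y \<otimes> ?c) = y"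
        using yG C.mem_carrier[OF c] by (simp add: m_assoc)
      then have "(inv g \<otimes> y \<otimes> g) \<otimes> y \<otimes> inv (inv g \<otimes> y \<otimes> g) = y [^] (1::nat)"
        unfolding zc using yG by simp
      moreover have "inv g \<otimes> y \<otimes> g \<in> T"
        using True y(1) g by auto
      ultimately show ?thesis using conj[OF gG] by blast
    qed
    \<comment> \<open>The conjugate of \<open>y\<close> by \<open>z\<^sup>-\<^sup>1\<close> is the conjugate \<open>z y z\<^sup>-\<^sup>1\<close> that the condition on \<open>z\<close> asks about.\<close>
    from this[of "inv ?z"] obtain m where "?z \<otimes> y \<otimes> inv ?z = y [^] (m::nat)"
      using zP zG by auto
    then obtain n where "?z = y [^] (n::nat)"
      using conj[OF vG] zP True by blast
    then have "?z = y [^] n \<otimes> \<one>" using yG by simp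
    then show ?thesis using C.one_closed by blast
  next
    case False
    have "P \<inter> T \<subseteq> C"
    proof (rule invariant_subgroup_fixed)
      show "subgroup (P \<inter> T) G"
        using P.subgroup_axioms T.subgroup_axioms by (rule subgroups_Inter_pair)
      show "v \<otimes> s \<otimes> inv v \<in> P \<inter> T" if "s \<in> P \<inter> T" for s
        using that P_conj_v T.inv_op_closed2 vG by blast
    qed (use False in auto)
    moreover obtain n t where nt: "t \<in> T" "?z = y [^] (n::nat) \<otimes> t"
      using prod[OF zG] by blast
    moreover have "t = inv (y [^] n) \<otimes> ?z"
      unfolding nt(2) using yG nt(1) by simp
    then have "t \<in> P" using ypow zP by simp
    ultimately show ?thesis by blast
  qed
  then obtain k c where c: "c \<in> C" "?z = y [^] (k::nat) \<otimes> c" by blast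
  have cG: "c \<in> carrier G" using c(1) by simp
  have "y = v \<otimes> ?z \<otimes> inv v"
    using yG vG by (simp add: word_simps)
  also have "\<dots> = (v \<otimes> y [^] k \<otimes> inv v) \<otimes> (v \<otimes> c \<otimes> inv v)"
    unfolding c(2) using yG cG vG by (simp add: word_simps)
  also have "v \<otimes> c \<otimes> inv v = c" using c(1) C_iff by blast
  finally have yk: "y = (v \<otimes> y [^] k \<otimes> inv v) \<otimes> c" .
  have y2: "y [^] (2 * j) \<in> C" for j :: nat
    using C_pow[OF pth_power_in_C[OF y(1)], of j] yG p by (simp add: nat_pow_pow)
  show False
  proof (cases "even k")
    case True
    then obtain j where "k = 2 * j" by blast
    then have "v \<otimes> y [^] k \<otimes> inv v \<in> C"
      using y2[of j] C_iff by simp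
    then have "y \<in> C" using yk c(1) C.m_closed by metis
    then show False using y(2) by blast
  next
    case False
    then obtain j where k: "k = Suc (2 * j)" by (auto elim: oddE)
    let ?d = "y [^] (2 * j)"
    have d: "v \<otimes> ?d \<otimes> inv v = ?d" using y2[of j] C_iff by blast
    have "v \<otimes> y [^] k \<otimes> inv v = (v \<otimes> ?d \<otimes> inv v) \<otimes> (v \<otimes> y \<otimes> inv v)"
      unfolding k using yG vG by (simp add: word_simps)
    then have "y = ?d \<otimes> (v \<otimes> y \<otimes> inv v) \<otimes> c"
      using yk unfolding d by simp
    then have "y \<otimes> inv y = ?d \<otimes> (v \<otimes> y \<otimes> inv v) \<otimes> c \<otimes> inv y" by simp
    also have "\<dots> = ?d \<otimes> (v \<otimes> y \<otimes> inv v) \<otimes> (c \<otimes> inv y)"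
      using yG vG cG by (simp add: m_assoc)
    also have "c \<otimes> inv y = inv y \<otimes> c"
      using C_central[OF P.m_inv_closed[OF y(1)] c(1)] by simp
    finally have "\<one> = ?d \<otimes> (v \<otimes> y \<otimes> inv v \<otimes> inv y) \<otimes> c"
      using yG vG cG by (simp add: m_assoc)
    then have "inv ?d \<otimes> \<one> \<otimes> inv c = v \<otimes> y \<otimes> inv v \<otimes> inv y"
      using yG vG cG by (simp add: m_assoc)
    moreover have "inv ?d \<otimes> \<one> \<otimes> inv c \<in> C"
      using y2[of j] c(1) by simp
    ultimately have "y \<in> C"
      using fixed_if_commutator_fixed[OF y(1)] by simp
    then show False using y(2) by blast
  qed
qed

section \<open>The nilpotency criterion\<close>

text \<open>The elementwise consequences of the hypotheses of the theorem. They mention \<open>E\<close> only through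
  membership of elements, so for a subgroup they hold with the same set \<open>E\<close>, and induction on the
  order of the group is possible.\<close>

definition nilpotency_conditions :: "'a set \<Rightarrow> ('a, 'b) monoid_scheme \<Rightarrow> bool"
  where "nilpotency_conditions E G \<longleftrightarrow>
    (\<forall>p q. \<forall>z \<in> carrier G \<inter> E. \<forall>x \<in> p_elements q G. prime p \<longrightarrow> prime q \<longrightarrow> p \<noteq> q \<longrightarrow>
      z [^]\<^bsub>G\<^esub> p = \<one>\<^bsub>G\<^esub> \<longrightarrow> z \<otimes>\<^bsub>G\<^esub> x = x \<otimes>\<^bsub>G\<^esub> z) \<and>
    (\<forall>y \<in> carrier G \<inter> E. y [^]\<^bsub>G\<^esub> (4::nat) = \<one>\<^bsub>G\<^esub> \<longrightarrow> y [^]\<^bsub>G\<^esub> (2::nat) \<noteq> \<one>\<^bsub>G\<^esub> \<longrightarrow> HC_element y G) \<and>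
    (\<forall>p q. \<forall>x \<in> p_elements p G. \<forall>y \<in> p_elements q G. prime p \<longrightarrow> prime q \<longrightarrow> p \<noteq> q \<longrightarrow>
      x \<otimes>\<^bsub>G\<^esub> y \<otimes>\<^bsub>G\<^esub> inv\<^bsub>G\<^esub> x \<otimes>\<^bsub>G\<^esub> inv\<^bsub>G\<^esub> y \<in> E)"

lemma (in group) nilpotency_conditions_subgroup:
  assumes cond: "nilpotency_conditions E G" and M: "subgroup M G"
  shows "nilpotency_conditions E (G\<lparr>carrier := M\<rparr>)"
proof -
  have MG: "M \<subseteq> carrier G" using M by (rule subgroup.subset)
  have pow: "x [^]\<^bsub>G\<lparr>carrier := M\<rparr>\<^esub> n = x [^] n" for x and n :: nat
    by (simp add: nat_pow_def)
  have inv: "inv\<^bsub>G\<lparr>carrier := M\<rparr>\<^esub> x = inv x" if "x \<in> M" for x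
    using M that by (rule m_inv_consistent)
  have prime_order: "z \<otimes> x = x \<otimes> z"
    if "z \<in> M" "z \<in> E" "x \<in> p_elements q G" "x \<in> M" "prime p" "prime q" "p \<noteq> q" "z [^] p = \<one>"
    for p q z x
    using cond that MG unfolding nilpotency_conditions_def by blast
  have order_4: "HC_element y (G\<lparr>carrier := M\<rparr>)"
    if "y \<in> M \<inter> E" "y [^] (4::nat) = \<one>" "y [^] (2::nat) \<noteq> \<one>" for y
    using cond that MG HC_element_subgroup[OF _ M] unfolding nilpotency_conditions_def by blast
  have quotient: "x \<otimes> y \<otimes> inv x \<otimes> inv y \<in> E"
    if "x \<in> p_elements p G" "x \<in> M" "y \<in> p_elements q G" "y \<in> M" "prime p" "prime q" "p \<noteq> q"
    for p q x y
    using cond that unfolding nilpotency_conditions_def by blast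
  show ?thesis
    unfolding nilpotency_conditions_def p_elements_subgroup[OF MG] pow
  proof (intro conjI allI ballI impI, goal_cases)
    case (1 p q z x)
    then show ?case using prime_order[of z x q p] by simp
  next
    case 2
    then show ?case using order_4 by simp
  next
    case (3 p q x y)
    then show ?case using quotient[of x p y q] by (simp add: inv)
  qed
qed

lemma (in schmidt_group) not_nilpotency_conditions: "\<not> nilpotency_conditions E G"
proof
  assume cond: "nilpotency_conditions E G"
  obtain a where a: "a \<in> P" "commutator v a \<notin> C"
    using commutator_with_v_outside_C by blast
  let ?y = "commutator v a"
  have aG: "a \<in> carrier G" using a(1) by simp
  have yG: "?y \<in> carrier G" using aG vG by simp
  have yP: "?y \<in> P"
    unfolding commutator_def using a(1) P_conj_v by simp
  have ap: "a \<in> p_elements p G" using a(1) P(2) by blast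
  have quotient: "\<forall>p q. \<forall>x \<in> p_elements p G. \<forall>y \<in> p_elements q G. prime p \<longrightarrow> prime q \<longrightarrow> p \<noteq> q \<longrightarrow>
      x \<otimes> y \<otimes> inv x \<otimes> inv y \<in> E"
    using cond unfolding nilpotency_conditions_def by (elim conjE)
  have yE: "?y \<in> E"
    unfolding commutator_def
    using quotient[rule_format, OF v ap primes(2,1) primes(3)[symmetric]] .
  have nontriv: "?y [^] p \<noteq> \<one>"
  proof
    assume "?y [^] p = \<one>"
    then have "?y \<otimes> v = v \<otimes> ?y"
      using cond primes v yE yG unfolding nilpotency_conditions_def by blast
    then show False
      using a(2) yP unfolding C_def by simp
  qed
  then have p: "p = 2"
    using commutator_with_v_order[OF a(1)] by presburger
  then have "?y [^] (4::nat) = \<one>"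
    using commutator_with_v_order[OF a(1)] by simp
  then have "HC_element ?y G"
    using cond yE yG nontriv p unfolding nilpotency_conditions_def by blast
  then show False
    using not_HC_element[OF p yP a(2)] by blast
qed

text \<open>By induction all proper subgroups satisfy the conclusion, so a counterexample is minimal
  non-nilpotent.\<close>

lemma nilpotency_conditions_imp_primary_commuting:
  assumes "group G" "finite (carrier G)" "nilpotency_conditions E G"
  shows "primary_commuting G"
  using assms
proof (induction "card (carrier G)" arbitrary: G rule: less_induct)
  case less
  interpret group G by (fact less.prems)
  show ?case
  proof (rule ccontr)
    assume "\<not> primary_commuting G"
    moreover have "primary_commuting (G\<lparr>carrier := H\<rparr>)" if H: "subgroup H G" "H \<noteq> carrier G" for H
    proof (rule less.hyps)
      have HG: "H \<subseteq> carrier G" using H(1) by (rule subgroup.subset)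
      then show "card (carrier (G\<lparr>carrier := H\<rparr>)) < card (carrier G)"
        using H(2) less.prems(2) by (simp add: psubset_card_mono psubset_eq)
      show "group (G\<lparr>carrier := H\<rparr>)" using H(1) by (rule subgroup_imp_group)
      show "finite (carrier (G\<lparr>carrier := H\<rparr>))"
        using HG less.prems(2) finite_subset by simp blast
      show "nilpotency_conditions E (G\<lparr>carrier := H\<rparr>)"
        using less.prems(3) H(1) by (rule nilpotency_conditions_subgroup)
    qed
    ultimately interpret minimal_non_nilpotent G
      using less.prems(2) by unfold_locales blast+
    obtain p q P v where "schmidt_group G p q P v"
      using schmidt_structure by blast
    from schmidt_group.not_nilpotency_conditions[OF this] show False
      using less.prems(3) by (rule notE)
  qed
qed

lemma (in group) nilpotency_conditionsI:
  assumes fin: "finite (carrier G)" and E: "E \<lhd> G" and nilp: "nilpotent_group (G Mod E)"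
    and minimal: "\<And>P. minimal_subgroup P (G\<lparr>carrier := E\<rparr>) \<Longrightarrow> P \<subseteq> hypercenter G"
    and cyclic_4: "\<And>H. \<lbrakk>cyclic_subgroup H (G\<lparr>carrier := E\<rparr>); card H = 4\<rbrakk> \<Longrightarrow> HC_subgroup H G"
  shows "nilpotency_conditions E G"
proof -
  interpret E: normal E G by (fact E)
  interpret Q: group "G Mod E" by (fact E.factorgroup_is_group)
  have cyc: "subgroup (generate G {z}) (G\<lparr>carrier := E\<rparr>)" if z: "z \<in> E" for z
  proof (rule subgroup_incl[OF _ E.subgroup_axioms])
    show "subgroup (generate G {z}) G"
      using z by (intro generate_is_subgroup) simp
    show "generate G {z} \<subseteq> E"
      using z E.subgroup_axioms by (intro generate_subgroup_incl) simp
  qed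
  have min: "z \<in> hypercenter G" if z: "z \<in> E" "prime p" "z [^] p = \<one>" for z and p :: nat
  proof (cases "z = \<one>")
    case True
    then have "z \<in> upper_central G 0" by simp
    then show ?thesis unfolding hypercenter_def by blast
  next
    case False
    have zG: "z \<in> carrier G" using z(1) by simp
    have "ord z dvd p" using z(3) pow_eq_id[OF zG] by simp
    moreover have "ord z \<noteq> 1" using False pow_ord_eq_1[OF zG] zG by (intro notI) simp
    ultimately have "ord z = p" using z(2) prime_nat_iff by blast
    then have "minimal_subgroup (generate G {z}) (G\<lparr>carrier := E\<rparr>)"
      unfolding minimal_subgroup_def using cyc[OF z(1)] generate_pow_card[OF zG] z(2) by simp
    then show ?thesis
      using minimal generate.incl[of z "{z}" G] by blast
  qed
  have HC: "HC_element y G" if y: "y \<in> E" "y [^] (4::nat) = \<one>" "y [^] (2::nat) \<noteq> \<one>" for y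
  proof (rule HC_subgroup_imp_HC_element[OF _ fin])
    let ?H = "generate G {y}"
    show yG: "y \<in> carrier G" using y(1) by simp
    have "ord y dvd 2 ^ 2" using y(2) pow_eq_id[OF yG] by simp
    then obtain i where i: "i \<le> 2" "ord y = 2 ^ i"
      using divides_primepow_nat[OF two_is_prime_nat] by blast
    have "\<not> ord y dvd 2" using y(3) pow_eq_id[OF yG] by simp
    then have "\<not> i \<le> 1" using i(2) le_imp_power_dvd[of i 1 "2::nat"] by auto
    then have "i = 2" using i(1) by simp
    then have "card ?H = 4" using i(2) generate_pow_card[OF yG] by simp
    moreover have "cyclic_subgroup ?H (G\<lparr>carrier := E\<rparr>)"
    proof -
      have sH: "subgroup ?H G" using yG by (intro generate_is_subgroup) simp
      interpret H: group "G\<lparr>carrier := ?H\<rparr>" using sH by (rule subgroup_imp_group)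
      have yH: "y \<in> ?H" by (rule generate.incl) simp
      have "?H = range (\<lambda>n::int. y [^] n)"
        using generate_pow[OF yG] by auto
      also have "\<dots> = range (\<lambda>n::int. y [^]\<^bsub>G\<lparr>carrier := ?H\<rparr>\<^esub> n)"
        using int_pow_consistent[OF sH yH] by simp
      finally have "cyclic_group (G\<lparr>carrier := ?H\<rparr>)"
        unfolding H.cyclic_group using yH by (intro bexI[of _ y]) simp_all
      then show ?thesis
        unfolding cyclic_subgroup_def using cyc[OF y(1)] by simp
    qed
    ultimately show "HC_subgroup ?H G" using cyclic_4 by blast
  qed
  have com: "commutator x y \<in> E"
    if "prime p" "prime q" "p \<noteq> q" "x \<in> p_elements p G" "y \<in> p_elements q G" for p q x y
    using E.FactGroup_primary_commuting_commutator[OF Q.nilpotent_imp_primary_commuting[OF nilp] that] .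
  show ?thesis
    unfolding nilpotency_conditions_def
  proof (intro conjI allI ballI impI)
    fix p q z x assume p: "prime p" "prime (q::nat)" "p \<noteq> q" and z: "z \<in> carrier G \<inter> E" "z [^] p = \<one>"
      and x: "x \<in> p_elements q G"
    have "z \<in> p_elements p G"
      unfolding p_elements_def using z by (auto intro!: exI[of _ 1])
    then show "z \<otimes> x = x \<otimes> z"
      using hypercenter_p_elements_commute[OF p] min[OF _ p(1) z(2)] z(1) x by blast
  next
    fix y assume "y \<in> carrier G \<inter> E" "y [^] (4::nat) = \<one>" "y [^] (2::nat) \<noteq> \<one>"
    then show "HC_element y G" using HC by blast
  next
    fix p q x y assume "x \<in> p_elements p G" "y \<in> p_elements q G" "prime p" "prime q" "p \<noteq> q"
    then show "x \<otimes> y \<otimes> inv x \<otimes> inv y \<in> E"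
      using com unfolding commutator_def by blast
  qed
qed

theorem theorem3p5:
  fixes G :: "('a, 'b) monoid_scheme" and E :: "'a set"
  assumes "group G" and "finite (carrier G)"
    and "E \<lhd> G" and "nilpotent_group (G Mod E)"
    and "\<And>P. minimal_subgroup P (G\<lparr>carrier := E\<rparr>) \<Longrightarrow> P \<subseteq> hypercenter G"
    and "\<And>H. \<lbrakk>cyclic_subgroup H (G\<lparr>carrier := E\<rparr>); card H = 4\<rbrakk> \<Longrightarrow> HC_subgroup H G"
  shows "nilpotent_group G"
proof -
  interpret group G by (fact assms(1))
  have "nilpotency_conditions E G"
    using assms(2-6) by (rule nilpotency_conditionsI)
  then have "primary_commuting G"
    using nilpotency_conditions_imp_primary_commuting assms(1,2) by blast
  then show ?thesis
    using primary_commuting_imp_nilpotent assms(2) by blast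
qed

end
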